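(* Let $\widetilde{H}$ be the affine Hecke algebra of type $G_2$. Assume $q^2=-1$, let $r\in\mathbb{C}^\times$ be a third root of $q^2$ (i.e. $r^3=q^2$) not equal to $q^{\pm2}$ or $\pm q^{\pm1}$, and let $t=t_{r,1}$. Put $t'=s_1t$ (so that $t'(X^{\alpha_2})=q^2$) and $w_0=s_1s_2s_1s_2s_1s_2$. Let $\mathbb{C}v_{t'}$ and $\mathbb{C}v_{w_0t'}$ be the $1$-dimensional $\widetilde{H}_{\{2\}}$-modules given by $T_2v_{t'}=qv_{t'}$, $X^\lambda v_{t'}=t'(X^\lambda)v_{t'}$, and $T_2v_{w_0t'}=-q^{-1}v_{w_0t'}$, $X^\lambda v_{w_0t'}=(w_0t')(X^\lambda)v_{w_0t'}$, and let $M=\widetilde{H}\otimes_{\widetilde{H}_{\{2\}}}\mathbb{C}v_{t'}$ and $N=\widetilde{H}\otimes_{\widetilde{H}_{\{2\}}}\mathbb{C}v_{w_0t'}$. Then $M$ and $N$ each have an irreducible $2$-dimensional submodule consisting of (i.e. equal to the sum of) their $s_2s_1t$ and $s_1s_2s_1t$ weight spaces. The resulting quotients of $M$ and of $N$ are irreducible.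
   Context: The type $G_2$ root system has simple roots $\alpha_1,\alpha_2$ with $\langle\alpha_1,\alpha_2^\vee\rangle=-1$, $\langle\alpha_2,\alpha_1^\vee\rangle=-3$; $s_i\lambda=\lambda-\langle\lambda,\alpha_i^\vee\rangle\alpha_i$, and $W_0=\langle s_1,s_2\rangle$. $P=\mathbb{Z}\alpha_1+\mathbb{Z}\alpha_2$ is the weight lattice; $X=\{X^\lambda\mid\lambda\in P\}$, $X^\lambda X^\mu=X^{\lambda+\mu}$. For $q\in\mathbb{C}^\times$, $\widetilde{H}$ is the $\mathbb{C}$-algebra generated by $T_1,T_2$ and $X^\lambda$ ($\lambda\in P$), with the group algebra $\mathbb{C}[X]$ a subalgebra, subject to $T_i^2=(q-q^{-1})T_i+1$, $T_1T_2T_1T_2T_1T_2=T_2T_1T_2T_1T_2T_1$, and $X^\lambda T_i=T_iX^{s_i\lambda}+(q-q^{-1})\frac{X^\lambda-X^{s_i\lambda}}{1-X^{-\alpha_i}}$. $\widetilde{H}_{\{i\}}$ is the subalgebra generated by $T_i$ and $\mathbb{C}[X]$. Weights are elements of $T=\mathrm{Hom}(X,\mathbb{C}^\times)$, with $W_0$-action $(wt)(X^\lambda)=t(X^{w^{-1}\lambda})$; $t_{z,w}\in T$ is given by $t_{z,w}(X^{\alpha_1})=z$, $t_{z,w}(X^{\alpha_2})=w$. For a finite-dimensional $\widetilde{H}$-module $M$ and $u\in T$, the $u$ weight space is $M_u=\{m\mid X^\lambda m=u(X^\lambda)m\ \forall\lambda\in P\}$. *)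

theory Defs
  imports "HOL-Algebra.Algebra" "HOL-Algebra.Algebraic_Closure_Type" "HOL-Library.Product_Plus"
    "HOL.Complex"
begin

section \<open>The root system\<close>

datatype node = N1 | N2

text \<open>The pair \<open>(a, b)\<close> stands for \<open>a \<alpha>\<^sub>1 + b \<alpha>\<^sub>2\<close>.\<close>

type_synonym lattice = "int \<times> int"

fun simple_root :: "node \<Rightarrow> lattice" where
  "simple_root N1 = (1, 0)"
| "simple_root N2 = (0, 1)"

text \<open>\<open>cartan i j\<close> is \<open>\<langle>\<alpha>\<^sub>i, \<alpha>\<^sub>j\<^sup>\<or>\<rangle>\<close>.\<close>

fun cartan :: "node \<Rightarrow> node \<Rightarrow> int" where
  "cartan N1 N1 = 2"
| "cartan N1 N2 = -1"
| "cartan N2 N1 = -3"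
| "cartan N2 N2 = 2"

definition coroot_pairing :: "lattice \<Rightarrow> node \<Rightarrow> int" where
  "coroot_pairing l i = fst l * cartan N1 i + snd l * cartan N2 i"

definition root_multiple :: "int \<Rightarrow> node \<Rightarrow> lattice" where
  "root_multiple k i = (k * fst (simple_root i), k * snd (simple_root i))"

definition simple_refl :: "node \<Rightarrow> lattice \<Rightarrow> lattice" where
  "simple_refl i l = l - root_multiple (coroot_pairing l i) i"

text \<open>Elements of \<open>Hom(X, \<complex>\<^sup>\<times>)\<close> are functions on the lattice; elements of the Weyl group are
  the corresponding permutations of the lattice.\<close>

type_synonym weight = "lattice \<Rightarrow> complex"

definition weight_at :: "complex \<Rightarrow> complex \<Rightarrow> weight" where
  "weight_at z w = (\<lambda>(a, b). z powi a * w powi b)"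

definition weyl_act :: "(lattice \<Rightarrow> lattice) \<Rightarrow> weight \<Rightarrow> weight" where
  "weyl_act w t = (\<lambda>l. t (inv_into UNIV w l))"

text \<open>For \<open>e l = X\<^bsup>l\<^esup>\<close>, this is the element \<open>(X\<^bsup>l\<^esup> - X\<^bsup>s\<^sub>i l\<^esup>) / (1 - X\<^bsup>-\<alpha>\<^sub>i\<^esup>)\<close> of the group algebra: since
  \<open>s\<^sub>i l = l - k \<alpha>\<^sub>i\<close>, the quotient is a finite geometric sum; see \<open>demazure_mult\<close> below.\<close>

definition demazure :: "(lattice \<Rightarrow> 'a::ab_group_add) \<Rightarrow> node \<Rightarrow> lattice \<Rightarrow> 'a" where
  "demazure e i l =
     (let k = coroot_pairing l i in
      if 0 \<le> k then (\<Sum>j\<in>{0..<k}. e (l - root_multiple j i))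
      else - (\<Sum>j\<in>{k..<0}. e (l - root_multiple j i)))"

section \<open>The affine Hecke algebra\<close>

text \<open>Words under concatenation; the finitely supported complex functions on words then form the
  free algebra, with convolution as product.\<close>

instantiation list :: (type) monoid_add
begin

definition zero_list :: "'a list" where "zero_list = []"

definition plus_list :: "'a list \<Rightarrow> 'a list \<Rightarrow> 'a list" where "plus_list xs ys = xs @ ys"

instance by standard (simp_all add: zero_list_def plus_list_def)

end

datatype gen = GT node | GX lattice

type_synonym free_alg = "gen list \<Rightarrow>\<^sub>0 complex"

abbreviation free_const :: "complex \<Rightarrow> free_alg" where
  "free_const c \<equiv> Poly_Mapping.single [] c"

abbreviation free_T :: "node \<Rightarrow> free_alg" where
  "free_T i \<equiv> Poly_Mapping.single [GT i] 1"

abbreviation free_X :: "lattice \<Rightarrow> free_alg" where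
  "free_X l \<equiv> Poly_Mapping.single [GX l] 1"

definition hecke_relations :: "complex \<Rightarrow> free_alg set" where
  "hecke_relations q =
     {free_X 0 - 1} \<union>
     {free_X l * free_X m - free_X (l + m) | l m. True} \<union>
     {free_T i * free_T i - (free_const (q - inverse q) * free_T i + 1) | i. True} \<union>
     {free_T N1 * free_T N2 * free_T N1 * free_T N2 * free_T N1 * free_T N2
      - free_T N2 * free_T N1 * free_T N2 * free_T N1 * free_T N2 * free_T N1} \<union>
     {free_X l * free_T i
      - (free_T i * free_X (simple_refl i l) + free_const (q - inverse q) * demazure free_X i l) | i l. True}"

type_synonym hecke_elt = "free_alg set"

definition hecke_ideal :: "complex \<Rightarrow> free_alg set" where
  "hecke_ideal q = genideal ring_of_type_algebra (hecke_relations q)"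

definition hecke :: "complex \<Rightarrow> hecke_elt ring" where
  "hecke q = ring_of_type_algebra Quot (hecke_ideal q)"

definition hecke_class :: "complex \<Rightarrow> free_alg \<Rightarrow> hecke_elt" where
  "hecke_class q f = hecke_ideal q +>\<^bsub>ring_of_type_algebra\<^esub> f"

definition hecke_const :: "complex \<Rightarrow> complex \<Rightarrow> hecke_elt" where
  "hecke_const q c = hecke_class q (free_const c)"

definition hecke_T :: "complex \<Rightarrow> node \<Rightarrow> hecke_elt" where
  "hecke_T q i = hecke_class q (free_T i)"

definition hecke_X :: "complex \<Rightarrow> lattice \<Rightarrow> hecke_elt" where
  "hecke_X q l = hecke_class q (free_X l)"

text \<open>The subalgebra generated by \<open>T\<^sub>i\<close> and \<open>\<complex>[X]\<close>, i.e.\ the subring generated by \<open>T\<^sub>i\<close>, the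
  \<open>X\<^bsup>l\<^esup>\<close> and the scalars.\<close>

definition hecke_parabolic :: "complex \<Rightarrow> node \<Rightarrow> hecke_elt ring" where
  "hecke_parabolic q i = (hecke q)\<lparr>carrier :=
     generate_ring (hecke q) (insert (hecke_T q i) (range (hecke_X q) \<union> range (hecke_const q)))\<rparr>"

section \<open>Modules over noncommutative rings\<close>

text \<open>The library locale \<open>module\<close> requires a commutative ring of scalars; its record type and its
  locale \<open>submodule\<close> do not, and are used here. The fields \<open>mult\<close> and \<open>one\<close> of
  the record play no role.\<close>

locale left_module = R?: ring R + M?: abelian_group M
  for R :: "('h, 'r) ring_scheme" (structure) and M :: "('h, 'm, 's) module_scheme" (structure) +
  assumes smult_closed: "\<lbrakk>a \<in> carrier R; x \<in> carrier M\<rbrakk> \<Longrightarrow> a \<odot>\<^bsub>M\<^esub> x \<in> carrier M"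
    and smult_l_distr: "\<lbrakk>a \<in> carrier R; b \<in> carrier R; x \<in> carrier M\<rbrakk> \<Longrightarrow>
      (a \<oplus>\<^bsub>R\<^esub> b) \<odot>\<^bsub>M\<^esub> x = a \<odot>\<^bsub>M\<^esub> x \<oplus>\<^bsub>M\<^esub> b \<odot>\<^bsub>M\<^esub> x"
    and smult_r_distr: "\<lbrakk>a \<in> carrier R; x \<in> carrier M; y \<in> carrier M\<rbrakk> \<Longrightarrow>
      a \<odot>\<^bsub>M\<^esub> (x \<oplus>\<^bsub>M\<^esub> y) = a \<odot>\<^bsub>M\<^esub> x \<oplus>\<^bsub>M\<^esub> a \<odot>\<^bsub>M\<^esub> y"
    and smult_assoc: "\<lbrakk>a \<in> carrier R; b \<in> carrier R; x \<in> carrier M\<rbrakk> \<Longrightarrow>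
      (a \<otimes>\<^bsub>R\<^esub> b) \<odot>\<^bsub>M\<^esub> x = a \<odot>\<^bsub>M\<^esub> (b \<odot>\<^bsub>M\<^esub> x)"
    and smult_one: "x \<in> carrier M \<Longrightarrow> \<one>\<^bsub>R\<^esub> \<odot>\<^bsub>M\<^esub> x = x"

definition irreducible_module :: "'h ring \<Rightarrow> ('h, 'm) module \<Rightarrow> bool" where
  "irreducible_module R M \<longleftrightarrow>
     left_module R M \<and> carrier M \<noteq> {\<zero>\<^bsub>M\<^esub>} \<and>
     (\<forall>S. submodule S R M \<longrightarrow> S = {\<zero>\<^bsub>M\<^esub>} \<or> S = carrier M)"

definition quotient_module :: "('h, 'm) module \<Rightarrow> 'm set \<Rightarrow> ('h, 'm set) module" where
  "quotient_module M S =
     \<lparr>carrier = a_rcosets\<^bsub>M\<^esub> S, monoid.mult = undefined, one = undefined,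
      ring.zero = S, add = set_add M,
      module.smult = (\<lambda>h C. \<Union>x\<in>C. S +>\<^bsub>M\<^esub> (h \<odot>\<^bsub>M\<^esub> x))\<rparr>"

text \<open>The tensor product \<open>R \<otimes>\<^sub>A V\<close> of the right \<open>A\<close>-module \<open>R\<close> (with \<open>A\<close> a subring of \<open>R\<close>) and the
  left \<open>A\<close>-module \<open>V\<close>: the free abelian group on pairs modulo biadditivity and \<open>A\<close>-balancedness.
  The ring \<open>R\<close> acts by multiplication on the left factor. If \<open>A\<close> contains the scalars of an algebra,
  then balancedness includes bilinearity over the scalars.\<close>

definition tensor_relations ::
  "'h ring \<Rightarrow> 'h ring \<Rightarrow> ('h, 'v) module \<Rightarrow> ('h \<times> 'v \<Rightarrow>\<^sub>0 int) set" where
  "tensor_relations R A V =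
     {frag_of (g \<oplus>\<^bsub>R\<^esub> h, v) - frag_of (g, v) - frag_of (h, v) | g h v.
        g \<in> carrier R \<and> h \<in> carrier R \<and> v \<in> carrier V} \<union>
     {frag_of (h, v \<oplus>\<^bsub>V\<^esub> w) - frag_of (h, v) - frag_of (h, w) | h v w.
        h \<in> carrier R \<and> v \<in> carrier V \<and> w \<in> carrier V} \<union>
     {frag_of (h \<otimes>\<^bsub>R\<^esub> a, v) - frag_of (h, a \<odot>\<^bsub>V\<^esub> v) | h a v.
        h \<in> carrier R \<and> a \<in> carrier A \<and> v \<in> carrier V}"

definition induced_module ::
  "'h ring \<Rightarrow> 'h ring \<Rightarrow> ('h, 'v) module \<Rightarrow> ('h, ('h \<times> 'v \<Rightarrow>\<^sub>0 int) set) module" where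
  "induced_module R A V =
     (let F = free_Abelian_group (carrier R \<times> carrier V);
          K = generate F (tensor_relations R A V)
      in \<lparr>carrier = carrier (F Mod K), monoid.mult = undefined, one = undefined,
          ring.zero = \<one>\<^bsub>F Mod K\<^esub>, add = monoid.mult (F Mod K),
          module.smult = (\<lambda>h C. \<Union>x\<in>C. K #>\<^bsub>F\<^esub> frag_extend (\<lambda>(g, v). frag_of (h \<otimes>\<^bsub>R\<^esub> g, v)) x)\<rparr>)"

section \<open>Modules over the affine Hecke algebra\<close>

definition has_complex_dim :: "complex \<Rightarrow> (hecke_elt, 'm) module \<Rightarrow> nat \<Rightarrow> bool" where
  "has_complex_dim q M n \<longleftrightarrow>
     (\<exists>B \<subseteq> carrier M. finite B \<and> card B = n \<and>
        (\<forall>m\<in>carrier M. \<exists>!c. c \<in> extensional B \<and> m = (\<Oplus>\<^bsub>M\<^esub>b\<in>B. hecke_const q (c b) \<odot>\<^bsub>M\<^esub> b)))"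

definition weight_space :: "complex \<Rightarrow> (hecke_elt, 'm) module \<Rightarrow> weight \<Rightarrow> 'm set" where
  "weight_space q M u =
     {m \<in> carrier M. \<forall>l. hecke_X q l \<odot>\<^bsub>M\<^esub> m = hecke_const q (u l) \<odot>\<^bsub>M\<^esub> m}"

text \<open>\<open>V = \<complex>v\<close> is a one-dimensional module over the subalgebra generated by \<open>T\<^sub>i\<close> and \<open>\<complex>[X]\<close>, with
  \<open>T\<^sub>i v = c v\<close> and \<open>X\<^bsup>l\<^esup> v = u(X\<^bsup>l\<^esup>) v\<close>.\<close>

definition parabolic_line ::
  "complex \<Rightarrow> node \<Rightarrow> complex \<Rightarrow> weight \<Rightarrow> (hecke_elt, 'v) module \<Rightarrow> 'v \<Rightarrow> bool" where
  "parabolic_line q i c u V v \<longleftrightarrow>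
     left_module (hecke_parabolic q i) V \<and>
     v \<in> carrier V \<and> v \<noteq> \<zero>\<^bsub>V\<^esub> \<and> carrier V = range (\<lambda>z. hecke_const q z \<odot>\<^bsub>V\<^esub> v) \<and>
     hecke_T q i \<odot>\<^bsub>V\<^esub> v = hecke_const q c \<odot>\<^bsub>V\<^esub> v \<and>
     (\<forall>l. hecke_X q l \<odot>\<^bsub>V\<^esub> v = hecke_const q (u l) \<odot>\<^bsub>V\<^esub> v)"

section \<open>Consistency checks\<close>

lemma simple_refl_refl: "simple_refl i (simple_refl i l) = l"
  by (cases i; cases l) (simp_all add: simple_refl_def coroot_pairing_def root_multiple_def algebra_simps)

lemma inv_simple_refl: "inv_into UNIV (simple_refl i) = simple_refl i"
  by (rule Hilbert_Choice.inv_equality) (simp_all add: simple_refl_refl)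

lemma weyl_act_simple_refl_N1_root:
  assumes "r \<noteq> 0"
  shows "weyl_act (simple_refl N1) (weight_at r 1) (simple_root N2) = r ^ 3"
  using assms
  by (simp add: weyl_act_def inv_simple_refl simple_refl_def coroot_pairing_def root_multiple_def weight_at_def)

lemma demazure_mult:
  fixes e :: "lattice \<Rightarrow> 'a::ring_1"
  assumes mult: "\<And>l m. e l * e m = e (l + m)"
  shows "demazure e i l * (1 - e (- simple_root i)) = e l - e (simple_refl i l)"
proof -
  let ?f = "\<lambda>j. e (l - root_multiple j i)"
  have step: "?f j * (1 - e (- simple_root i)) = ?f j - ?f (j + 1)" for j
    by (cases i; cases l) (simp_all add: right_diff_distrib mult root_multiple_def algebra_simps)
  have tele: "(\<Sum>j\<in>{a..<a + int n}. ?f j - ?f (j + 1)) = ?f a - ?f (a + int n)" for a n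
  proof (induction n)
    case (Suc n)
    have "{a..<a + int (Suc n)} = insert (a + int n) {a..<a + int n}" by auto
    then show ?case using Suc by (simp add: algebra_simps)
  qed simp
  let ?k = "coroot_pairing l i"
  have f0: "?f 0 = e l" by (cases l) (simp add: root_multiple_def)
  show ?thesis
  proof (cases "0 \<le> ?k")
    case True
    then show ?thesis using tele[of 0 "nat ?k"] f0
      by (simp add: demazure_def Let_def sum_distrib_right step simple_refl_def)
  next
    case False
    then show ?thesis using tele[of ?k "nat (- ?k)"] f0
      by (simp add: demazure_def Let_def sum_distrib_right step simple_refl_def)
  qed
qed

lemma ring_hecke: "ring (hecke q)"
proof -
  have "ring (ring_of_type_algebra :: free_alg ring)"
  proof -
    have "\<exists>y. x + y = 0" "\<exists>y. y + x = 0" for x :: free_alg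
      by (metis add.right_inverse, metis add.left_inverse)
    then show ?thesis unfolding ring_of_type_algebra_def
      by unfold_locales (auto simp: algebra_simps Units_def intro: exI[of _ "- _"])
  qed
  then show ?thesis unfolding hecke_def hecke_ideal_def
    by (intro ideal.quotient_is_ring ring.genideal_ideal) (auto simp: ring_of_type_algebra_def)
qed

end

theory Submission
  imports Defs
begin

text \<open>Since \<open>q\<^sup>2 = -1\<close>, the two eigenvalues \<open>q\<close> and \<open>-q\<^bsup>-1\<^esup>\<close> of \<open>T\<^sub>i\<close> coincide. From \<open>r\<^sup>3 = -1\<close> and \<open>r \<noteq> -1\<close> it follows that \<open>r\<close> is
a primitive sixth root of unity, i.e.\ \<open>r\<^sup>2 = r - 1\<close>, and so is \<open>r\<^bsup>-1\<^esup>\<close>. In terms of their values on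
\<open>\<alpha>\<^sub>1, \<alpha>\<^sub>2\<close> the weights are \<open>t' = (r\<^bsup>-1\<^esup>, -1)\<close>, \<open>w\<^sub>0t' = (r, -1)\<close>, \<open>u\<^sub>1 = (-r\<^bsup>-1\<^esup>, -1)\<close> and \<open>u\<^sub>2 = (-r, -1)\<close>. Hence \<open>N\<close> arises from \<open>M\<close>
on replacing \<open>r\<close> by \<open>r\<^bsup>-1\<^esup>\<close>, which exchanges \<open>u\<^sub>1\<close> and \<open>u\<^sub>2\<close>, and it suffices to treat one module for a
primitive sixth root of unity \<open>\<rho>\<close>.

The induced module is spanned by six vectors \<open>T\<^sub>w \<otimes> v\<close>: their span is stable under the \<open>T\<^sub>i\<close> by the quadratic
and braid relations, and then under the \<open>X\<^bsup>l\<^esup>\<close>, which can be commuted past the \<open>T\<^sub>i\<close>. That these vectors are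
independent is seen in an explicit six-dimensional module, where the defining relations are checked
by matrix computation (\<open>braid_U\<close>, \<open>bernstein_U\<close>) and to which the induced module maps by its universal
property. So the induced module is isomorphic to the explicit one (\<open>exists_model\<close>).

The explicit module is written in a basis \<open>h\<^sub>0, h\<^sub>1, g\<^sub>0, g\<^sub>1, f\<^sub>1, f\<^sub>2\<close> of generalized weight vectors of the
weights \<open>t', t', t, t, u\<^sub>1, u\<^sub>2\<close>, in which the assertions can be read off. The plane of \<open>f\<^sub>1\<close> and \<open>f\<^sub>2\<close> is stable,
because \<open>T\<^sub>2\<close> acts on it by \<open>q\<close>; it is irreducible, because its two weights differ and \<open>T\<^sub>1\<close> mixes \<open>f\<^sub>1\<close> and \<open>f\<^sub>2\<close>
(\<open>stable_simple_plane\<close>). In the quotient both generalized weight spaces are single Jordan blocks, so any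
nonzero submodule contains \<open>h\<^sub>0\<close> or \<open>g\<^sub>0\<close>. As \<open>T\<^sub>1\<close> carries \<open>g\<^sub>0\<close> to a vector involving \<open>h\<^sub>0\<close>, it contains \<open>h\<^sub>0\<close>,
the image of the generator \<open>1 \<otimes> v\<close>, and is everything (\<open>stable_simple_quotient\<close>).\<close>

section \<open>Left modules\<close>

(* Membership in a free abelian group stays folded, so that closure lemmas about its carrier apply. *)
declare carrier_free_Abelian_group_iff [simp del]

context left_module
begin

lemma smult_zero [simp]: "a \<in> carrier R \<Longrightarrow> a \<odot>\<^bsub>M\<^esub> \<zero>\<^bsub>M\<^esub> = \<zero>\<^bsub>M\<^esub>"
  using smult_r_distr[of a "\<zero>\<^bsub>M\<^esub>" "\<zero>\<^bsub>M\<^esub>"] smult_closed[of a "\<zero>\<^bsub>M\<^esub>"]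
  by (metis M.add.l_cancel_one' M.l_zero M.zero_closed)

lemma zero_smult [simp]: "x \<in> carrier M \<Longrightarrow> \<zero>\<^bsub>R\<^esub> \<odot>\<^bsub>M\<^esub> x = \<zero>\<^bsub>M\<^esub>"
  using smult_l_distr[of "\<zero>\<^bsub>R\<^esub>" "\<zero>\<^bsub>R\<^esub>" x] smult_closed[of "\<zero>\<^bsub>R\<^esub>" x]
  by (metis M.add.l_cancel_one' R.l_zero R.zero_closed)

lemma smult_minus:
  assumes "a \<in> carrier R" "x \<in> carrier M"
  shows "a \<odot>\<^bsub>M\<^esub> (\<ominus>\<^bsub>M\<^esub> x) = \<ominus>\<^bsub>M\<^esub> (a \<odot>\<^bsub>M\<^esub> x)"
  using assms by (intro M.minus_equality[symmetric]) (simp_all add: smult_closed smult_r_distr[symmetric] M.l_neg)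

lemma minus_smult:
  assumes "a \<in> carrier R" "x \<in> carrier M"
  shows "(\<ominus>\<^bsub>R\<^esub> a) \<odot>\<^bsub>M\<^esub> x = \<ominus>\<^bsub>M\<^esub> (a \<odot>\<^bsub>M\<^esub> x)"
  using assms by (intro M.minus_equality[symmetric]) (simp_all add: smult_closed smult_l_distr[symmetric] R.l_neg)

text \<open>Closure under negation comes for free, as it is the action of \<open>-1\<close>.\<close>

lemma submoduleI:
  assumes "S \<subseteq> carrier M" and "\<zero>\<^bsub>M\<^esub> \<in> S"
    and "\<And>x y. x \<in> S \<Longrightarrow> y \<in> S \<Longrightarrow> x \<oplus>\<^bsub>M\<^esub> y \<in> S"
    and smult: "\<And>a x. a \<in> carrier R \<Longrightarrow> x \<in> S \<Longrightarrow> a \<odot>\<^bsub>M\<^esub> x \<in> S"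
  shows "submodule S R M"
proof (intro submodule.intro subgroup.intro submodule_axioms.intro)
  show "inv\<^bsub>add_monoid M\<^esub> x \<in> S" if "x \<in> S" for x
    using smult[of "\<ominus>\<^bsub>R\<^esub> \<one>\<^bsub>R\<^esub>" x] that assms(1)
    by (auto simp: minus_smult smult_one a_inv_def[symmetric] subset_iff)
qed (use assms in auto)

lemma submodule_is_left_module:
  assumes "submodule S R M"
  shows "left_module R (M\<lparr>carrier := S\<rparr>)"
proof -
  interpret S: submodule S R M by fact
  have sub: "\<And>x. x \<in> S \<Longrightarrow> x \<in> carrier M" using S.subset by auto
  have neg: "\<exists>y\<in>S. y \<oplus>\<^bsub>M\<^esub> x = \<zero>\<^bsub>M\<^esub>" if "x \<in> S" for x
    using S.m_inv_closed[OF that] that by (intro bexI[of _ "\<ominus>\<^bsub>M\<^esub> x"]) (auto simp: a_inv_def[symmetric] sub M.l_neg)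
  have "abelian_group (M\<lparr>carrier := S\<rparr>)"
  proof (rule abelian_groupI)
    show "x \<oplus>\<^bsub>M\<lparr>carrier := S\<rparr>\<^esub> y \<in> carrier (M\<lparr>carrier := S\<rparr>)"
      if "x \<in> carrier (M\<lparr>carrier := S\<rparr>)" "y \<in> carrier (M\<lparr>carrier := S\<rparr>)" for x y
      using S.m_closed[of x y] that by simp
    show "x \<oplus>\<^bsub>M\<lparr>carrier := S\<rparr>\<^esub> y = y \<oplus>\<^bsub>M\<lparr>carrier := S\<rparr>\<^esub> x"
      if "x \<in> carrier (M\<lparr>carrier := S\<rparr>)" "y \<in> carrier (M\<lparr>carrier := S\<rparr>)" for x y
      using M.a_comm[of x y] that sub by simp
  qed (use S.one_closed neg in \<open>simp_all add: sub M.a_assoc\<close>)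
  then show ?thesis
    by (intro left_module.intro left_module_axioms.intro R.ring_axioms)
      (auto simp: sub smult_l_distr smult_r_distr smult_assoc smult_one)
qed

end

lemma irreducible_moduleI:
  assumes "left_module R M" and "carrier M \<noteq> {\<zero>\<^bsub>M\<^esub>}"
    and "\<And>S x. submodule S R M \<Longrightarrow> x \<in> S \<Longrightarrow> x \<noteq> \<zero>\<^bsub>M\<^esub> \<Longrightarrow> carrier M \<subseteq> S"
  shows "irreducible_module R M"
  unfolding irreducible_module_def
proof (intro conjI allI impI)
  fix S assume S: "submodule S R M"
  then have "S \<subseteq> carrier M" "\<zero>\<^bsub>M\<^esub> \<in> S"
    using subgroup.subset[OF submodule.axioms(1)[OF S]] subgroup.one_closed[OF submodule.axioms(1)[OF S]]
    by auto
  then show "S = {\<zero>\<^bsub>M\<^esub>} \<or> S = carrier M" using assms(3)[OF S] by blast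
qed (use assms in auto)

section \<open>Quotient modules\<close>

locale submodule_quotient = left_module R M for R :: "'h ring" (structure) and M :: "('h, 'm) module" (structure) +
  fixes S
  assumes submod: "submodule S R M"
begin

sublocale S: abelian_subgroup S M
  by (intro abelian_subgroupI3 additive_subgroupI M.abelian_group_axioms submodule.axioms(1)[OF submod])

lemma smult_S: "a \<in> carrier R \<Longrightarrow> x \<in> S \<Longrightarrow> a \<odot>\<^bsub>M\<^esub> x \<in> S"
  using submodule.smult_closed[OF submod] by blast

lemma quotient_carrier: "carrier (quotient_module M S) = (\<lambda>x. S +>\<^bsub>M\<^esub> x) ` carrier M"
  by (auto simp: quotient_module_def A_RCOSETS_def')

lemma quotient_add:
  "x \<in> carrier M \<Longrightarrow> y \<in> carrier M \<Longrightarrow>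
   (S +>\<^bsub>M\<^esub> x) \<oplus>\<^bsub>quotient_module M S\<^esub> (S +>\<^bsub>M\<^esub> y) = S +>\<^bsub>M\<^esub> (x \<oplus>\<^bsub>M\<^esub> y)"
  by (simp add: quotient_module_def S.a_rcos_sum)

lemma quotient_zero: "\<zero>\<^bsub>quotient_module M S\<^esub> = S"
  by (simp add: quotient_module_def)

text \<open>The union that defines the action on a coset is a union of equal cosets, because \<open>S\<close> is stable.\<close>

lemma quotient_smult:
  assumes a: "a \<in> carrier R" and x: "x \<in> carrier M"
  shows "a \<odot>\<^bsub>quotient_module M S\<^esub> (S +>\<^bsub>M\<^esub> x) = S +>\<^bsub>M\<^esub> (a \<odot>\<^bsub>M\<^esub> x)"
proof -
  have "S +>\<^bsub>M\<^esub> (a \<odot>\<^bsub>M\<^esub> y) = S +>\<^bsub>M\<^esub> (a \<odot>\<^bsub>M\<^esub> x)" if y: "y \<in> S +>\<^bsub>M\<^esub> x" for y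
  proof -
    obtain s where s: "s \<in> S" "y = s \<oplus>\<^bsub>M\<^esub> x" using y by (auto simp: a_r_coset_def')
    have sM: "s \<in> carrier M" using s S.a_subset by auto
    have "a \<odot>\<^bsub>M\<^esub> y = a \<odot>\<^bsub>M\<^esub> s \<oplus>\<^bsub>M\<^esub> a \<odot>\<^bsub>M\<^esub> x" using s sM a x by (simp add: smult_r_distr)
    also have "S +>\<^bsub>M\<^esub> \<dots> = (S +>\<^bsub>M\<^esub> (a \<odot>\<^bsub>M\<^esub> s)) +>\<^bsub>M\<^esub> (a \<odot>\<^bsub>M\<^esub> x)"
      using a x sM S.a_subset by (simp add: M.a_coset_add_assoc smult_closed)
    also have "S +>\<^bsub>M\<^esub> (a \<odot>\<^bsub>M\<^esub> s) = S"
      using a s sM by (intro M.a_coset_join2 S.a_subgroup) (auto simp: smult_closed smult_S)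
    finally show ?thesis .
  qed
  moreover have "S +>\<^bsub>M\<^esub> x \<noteq> {}" using S.a_rcos_self[OF x] by blast
  ultimately show ?thesis unfolding quotient_module_def by (simp add: SUP_eq_const)
qed

lemma quotient_is_left_module: "left_module R (quotient_module M S)"
proof -
  have S: "S = S +>\<^bsub>M\<^esub> \<zero>\<^bsub>M\<^esub>" using S.a_subset by simp
  have z: "\<zero>\<^bsub>quotient_module M S\<^esub> = S +>\<^bsub>M\<^esub> \<zero>\<^bsub>M\<^esub>" using S quotient_zero by simp
  have "abelian_group (quotient_module M S)"
  proof (rule abelian_groupI)
    show "x \<oplus>\<^bsub>quotient_module M S\<^esub> y = y \<oplus>\<^bsub>quotient_module M S\<^esub> x"
      if "x \<in> carrier (quotient_module M S)" "y \<in> carrier (quotient_module M S)" for x y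
      using that M.a_comm by (auto simp: quotient_carrier quotient_add)
    show "\<exists>y\<in>carrier (quotient_module M S). y \<oplus>\<^bsub>quotient_module M S\<^esub> x = \<zero>\<^bsub>quotient_module M S\<^esub>"
      if x: "x \<in> carrier (quotient_module M S)" for x
    proof -
      obtain m where m: "m \<in> carrier M" "x = S +>\<^bsub>M\<^esub> m" using x by (auto simp: quotient_carrier)
      then have "(S +>\<^bsub>M\<^esub> (\<ominus>\<^bsub>M\<^esub> m)) \<oplus>\<^bsub>quotient_module M S\<^esub> x = \<zero>\<^bsub>quotient_module M S\<^esub>"
        unfolding m z by (subst quotient_add) (simp_all add: M.l_neg)
      then show ?thesis using m by (auto simp: quotient_carrier)
    qed
  qed (auto simp: quotient_carrier quotient_add z M.a_assoc)
  then show ?thesis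
    by (intro left_module.intro left_module_axioms.intro R.ring_axioms)
      (auto simp add: quotient_carrier quotient_smult quotient_add smult_closed
        smult_one smult_assoc smult_l_distr smult_r_distr[symmetric])
qed

text \<open>The preimage in \<open>M\<close> of a submodule of the quotient contains \<open>S\<close>, and it contains it strictly if
the submodule is not zero.\<close>

lemma quotient_irreducible:
  assumes proper: "S \<noteq> carrier M"
    and maximal: "\<And>P x. submodule P R M \<Longrightarrow> S \<subseteq> P \<Longrightarrow> x \<in> P \<Longrightarrow> x \<notin> S \<Longrightarrow> carrier M \<subseteq> P"
  shows "irreducible_module R (quotient_module M S)"
proof (rule irreducible_moduleI[OF quotient_is_left_module])
  obtain x where "x \<in> carrier M" "x \<notin> S" using proper S.a_subset by auto
  then have "S +>\<^bsub>M\<^esub> x \<in> carrier (quotient_module M S)" "S +>\<^bsub>M\<^esub> x \<noteq> S"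
    using S.a_rcos_self by (auto simp: quotient_carrier)
  then show "carrier (quotient_module M S) \<noteq> {\<zero>\<^bsub>quotient_module M S\<^esub>}"
    by (auto simp: quotient_zero)
next
  fix Q C assume Q: "submodule Q R (quotient_module M S)"
    and C: "C \<in> Q" "C \<noteq> \<zero>\<^bsub>quotient_module M S\<^esub>"
  interpret Q: submodule Q R "quotient_module M S" by fact
  let ?P = "{x \<in> carrier M. S +>\<^bsub>M\<^esub> x \<in> Q}"
  have inS: "S +>\<^bsub>M\<^esub> x = S" if "x \<in> S" for x
    using that S.a_subset by (intro M.a_coset_join2 S.a_subgroup) auto
  have SQ: "S \<in> Q" using Q.one_closed by (simp add: quotient_zero)
  have "submodule ?P R M"
  proof (rule submoduleI)
    show "x \<oplus>\<^bsub>M\<^esub> y \<in> ?P" if "x \<in> ?P" "y \<in> ?P" for x y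
      using Q.m_closed[of "S +>\<^bsub>M\<^esub> x" "S +>\<^bsub>M\<^esub> y"] that by (simp add: quotient_add)
    show "a \<odot>\<^bsub>M\<^esub> x \<in> ?P" if "a \<in> carrier R" "x \<in> ?P" for a x
      using Q.smult_closed[of a "S +>\<^bsub>M\<^esub> x"] that quotient_smult[of a x] by (metis (lifting) mem_Collect_eq smult_closed)
  qed (use SQ inS[of "\<zero>\<^bsub>M\<^esub>"] in auto)
  moreover have "S \<subseteq> ?P" using SQ inS S.a_subset by auto
  moreover obtain x where "x \<in> carrier M" "C = S +>\<^bsub>M\<^esub> x"
    using C Q.subset by (auto simp: quotient_carrier)
  moreover have "x \<notin> S" using inS C calculation by (auto simp: quotient_zero)
  ultimately have "carrier M \<subseteq> ?P" using C by (intro maximal[of ?P x]) auto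
  then show "carrier (quotient_module M S) \<subseteq> Q" by (auto simp: quotient_carrier)
qed

end

section \<open>Induced modules\<close>

definition pure_tensor ::
  "'h ring \<Rightarrow> 'h ring \<Rightarrow> ('h, 'v) module \<Rightarrow> 'h \<Rightarrow> 'v \<Rightarrow> ('h \<times> 'v \<Rightarrow>\<^sub>0 int) set" where
  "pure_tensor R A V h v =
     (let F = free_Abelian_group (carrier R \<times> carrier V)
      in generate F (tensor_relations R A V) #>\<^bsub>F\<^esub> frag_of (h, v))"

locale induction_data = R: ring R + V: left_module A V
  for R A :: "'h ring" and V :: "('h, 'v) module" +
  assumes A_sub: "carrier A \<subseteq> carrier R"
begin

abbreviation "F \<equiv> free_Abelian_group (carrier R \<times> carrier V)"
abbreviation "K \<equiv> generate F (tensor_relations R A V)"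
abbreviation "I \<equiv> induced_module R A V"
abbreviation "pure \<equiv> pure_tensor R A V"

sublocale F: comm_group F by (rule abelian_free_Abelian_group)

lemma carrier_F_diff: "x \<in> carrier F \<Longrightarrow> y \<in> carrier F \<Longrightarrow> x - y \<in> carrier F"
  using keys_diff[of x y] by (auto simp: carrier_free_Abelian_group_iff)

lemma carrier_F_add: "x \<in> carrier F \<Longrightarrow> y \<in> carrier F \<Longrightarrow> x + y \<in> carrier F"
  using F.m_closed[of x y] by simp

lemma carrier_F_zero [simp]: "0 \<in> carrier F"
  by (simp add: carrier_free_Abelian_group_iff)

lemma relations_sub: "tensor_relations R A V \<subseteq> carrier F"
  unfolding tensor_relations_def
  using A_sub V.smult_closed by (auto intro!: carrier_F_diff simp: subset_iff)

lemma K_subgroup: "subgroup K F" by (rule F.generate_is_subgroup[OF relations_sub])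

lemma K_normal: "K \<lhd> F" using K_subgroup F.normal_iff_subgroup by blast

lemma K_sub: "k \<in> K \<Longrightarrow> k \<in> carrier F" using subgroup.subset[OF K_subgroup] by blast

lemma K_add: "x \<in> K \<Longrightarrow> y \<in> K \<Longrightarrow> x + y \<in> K"
  using subgroup.m_closed[OF K_subgroup, of x y] by simp

lemma K_zero: "0 \<in> K" using subgroup.one_closed[OF K_subgroup] by simp

lemma K_minus: "x \<in> K \<Longrightarrow> - x \<in> K"
  using subgroup.m_inv_closed[OF K_subgroup, of x] K_sub[of x]
  by (simp add: carrier_free_Abelian_group_iff)

lemma K_diff: "x \<in> K \<Longrightarrow> y \<in> K \<Longrightarrow> x - y \<in> K"
  using K_add[OF _ K_minus, of x y] by simp

lemma coset_eq:
  assumes "x \<in> carrier F" "y \<in> carrier F" "x - y \<in> K"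
  shows "K #>\<^bsub>F\<^esub> x = K #>\<^bsub>F\<^esub> y"
proof -
  have "x \<in> K #>\<^bsub>F\<^esub> y" using assms(3) by (auto simp: r_coset_def intro!: bexI[of _ "x - y"])
  then show ?thesis using F.repr_independence[OF _ assms(2) K_subgroup] by simp
qed

abbreviation "left_mult h \<equiv> frag_extend (\<lambda>(g, v). frag_of (h \<otimes>\<^bsub>R\<^esub> g, v))"

lemma left_mult_closed:
  assumes "h \<in> carrier R" "x \<in> carrier F"
  shows "left_mult h x \<in> carrier F"
  using assms keys_frag_extend[of "\<lambda>(g, v). frag_of (h \<otimes>\<^bsub>R\<^esub> g, v)" x]
  by (fastforce simp: carrier_free_Abelian_group_iff subset_iff)

text \<open>Left multiplication sends each defining relation of the tensor product to a relation of the same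
kind; this is why it descends to the quotient.\<close>

lemma left_mult_K:
  assumes h: "h \<in> carrier R" and "k \<in> K"
  shows "left_mult h k \<in> K"
  using assms(2)
proof (induction rule: generate.induct)
  have rel: "left_mult h x \<in> K" if "x \<in> tensor_relations R A V" for x
  proof -
    consider (left) g g' v where "x = frag_of (g \<oplus>\<^bsub>R\<^esub> g', v) - frag_of (g, v) - frag_of (g', v)"
        "g \<in> carrier R" "g' \<in> carrier R" "v \<in> carrier V"
      | (right) g v w where "x = frag_of (g, v \<oplus>\<^bsub>V\<^esub> w) - frag_of (g, v) - frag_of (g, w)"
        "g \<in> carrier R" "v \<in> carrier V" "w \<in> carrier V"
      | (bal) g a v where "x = frag_of (g \<otimes>\<^bsub>R\<^esub> a, v) - frag_of (g, a \<odot>\<^bsub>V\<^esub> v)"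
        "g \<in> carrier R" "a \<in> carrier A" "v \<in> carrier V"
      using \<open>x \<in> tensor_relations R A V\<close> unfolding tensor_relations_def by blast
    then have "left_mult h x \<in> tensor_relations R A V"
    proof cases
      case left
      then have "left_mult h x = frag_of (h \<otimes>\<^bsub>R\<^esub> g \<oplus>\<^bsub>R\<^esub> h \<otimes>\<^bsub>R\<^esub> g', v)
          - frag_of (h \<otimes>\<^bsub>R\<^esub> g, v) - frag_of (h \<otimes>\<^bsub>R\<^esub> g', v)"
        using h by (simp add: frag_extend_diff R.r_distr)
      moreover have "h \<otimes>\<^bsub>R\<^esub> g \<in> carrier R" "h \<otimes>\<^bsub>R\<^esub> g' \<in> carrier R" using left h by auto
      ultimately show ?thesis using left(4) unfolding tensor_relations_def by blast
    next
      case right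
      then have "left_mult h x = frag_of (h \<otimes>\<^bsub>R\<^esub> g, v \<oplus>\<^bsub>V\<^esub> w)
          - frag_of (h \<otimes>\<^bsub>R\<^esub> g, v) - frag_of (h \<otimes>\<^bsub>R\<^esub> g, w)"
        using h by (simp add: frag_extend_diff)
      moreover have "h \<otimes>\<^bsub>R\<^esub> g \<in> carrier R" using right h by auto
      ultimately show ?thesis using right(3,4) unfolding tensor_relations_def by blast
    next
      case bal
      then have "left_mult h x = frag_of ((h \<otimes>\<^bsub>R\<^esub> g) \<otimes>\<^bsub>R\<^esub> a, v) - frag_of (h \<otimes>\<^bsub>R\<^esub> g, a \<odot>\<^bsub>V\<^esub> v)"
        using h A_sub by (auto simp: frag_extend_diff R.m_assoc subset_iff)
      moreover have "h \<otimes>\<^bsub>R\<^esub> g \<in> carrier R" using bal h by auto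
      ultimately show ?thesis using bal(3,4) unfolding tensor_relations_def by blast
    qed
    then show ?thesis by (rule generate.incl)
  qed
  {
    case one
    then show ?case by (simp add: K_zero)
  next
    case (incl x)
    then show ?case by (rule rel)
  next
    case (inv x)
    have "Poly_Mapping.keys x \<subseteq> carrier R \<times> carrier V"
      using subsetD[OF relations_sub inv] by (simp add: carrier_free_Abelian_group_iff)
    then show ?case using rel[OF inv] by (simp add: frag_extend_minus K_minus)
  next
    case (eng x y)
    then show ?case by (simp add: frag_extend_add K_add)
  }
qed

lemma induced_carrier: "carrier I = (\<lambda>x. K #>\<^bsub>F\<^esub> x) ` carrier F"
  by (simp add: induced_module_def Let_def carrier_FactGroup)

lemma induced_add:
  "x \<in> carrier F \<Longrightarrow> y \<in> carrier F \<Longrightarrow> (K #>\<^bsub>F\<^esub> x) \<oplus>\<^bsub>I\<^esub> (K #>\<^bsub>F\<^esub> y) = K #>\<^bsub>F\<^esub> (x + y)"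
  using normal.rcos_sum[OF K_normal, of x y] by (simp add: induced_module_def Let_def)

lemma induced_zero: "\<zero>\<^bsub>I\<^esub> = K #>\<^bsub>F\<^esub> 0"
  using F.coset_mult_one[OF subgroup.subset[OF K_subgroup]] by (simp add: induced_module_def Let_def)

lemma induced_smult:
  assumes h: "h \<in> carrier R" and x: "x \<in> carrier F"
  shows "h \<odot>\<^bsub>I\<^esub> (K #>\<^bsub>F\<^esub> x) = K #>\<^bsub>F\<^esub> left_mult h x"
proof -
  have "K #>\<^bsub>F\<^esub> left_mult h y = K #>\<^bsub>F\<^esub> left_mult h x" if y: "y \<in> K #>\<^bsub>F\<^esub> x" for y
  proof (rule coset_eq)
    obtain k where k: "k \<in> K" "y = k + x" using y by (auto simp: r_coset_def)
    then show "left_mult h y \<in> carrier F"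
      using h x K_sub[of k] by (auto intro!: left_mult_closed carrier_F_add)
    show "left_mult h y - left_mult h x \<in> K"
      using k left_mult_K[OF h, of k] by (simp add: frag_extend_add)
  qed (rule left_mult_closed[OF h x])
  moreover have "K #>\<^bsub>F\<^esub> x \<noteq> {}" using F.rcos_self[OF x K_subgroup] by blast
  ultimately show ?thesis unfolding induced_module_def Let_def by (simp add: SUP_eq_const)
qed

text \<open>On the free abelian group left multiplication is not additive in the factor: it becomes so only
modulo the relations.\<close>

lemma left_mult_add_K:
  assumes "a \<in> carrier R" "b \<in> carrier R" "x \<in> carrier F"
  shows "left_mult (a \<oplus>\<^bsub>R\<^esub> b) x - (left_mult a x + left_mult b x) \<in> K"
proof -
  have "Poly_Mapping.keys x \<subseteq> carrier R \<times> carrier V"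
    using assms(3) by (simp add: carrier_free_Abelian_group_iff)
  then show ?thesis
  proof (induction x rule: frag_induction)
    case zero
    then show ?case by (simp add: K_zero)
  next
    case (one p)
    then obtain g v where p: "p = (g, v)" "g \<in> carrier R" "v \<in> carrier V" by auto
    have "frag_of (a \<otimes>\<^bsub>R\<^esub> g \<oplus>\<^bsub>R\<^esub> b \<otimes>\<^bsub>R\<^esub> g, v) - frag_of (a \<otimes>\<^bsub>R\<^esub> g, v) - frag_of (b \<otimes>\<^bsub>R\<^esub> g, v)
        \<in> tensor_relations R A V"
      unfolding tensor_relations_def using assms p by blast
    then show ?case using assms p by (simp add: R.l_distr diff_diff_add generate.incl)
  next
    case (diff x y)
    then show ?case using K_diff[OF diff] by (simp add: frag_extend_diff algebra_simps)
  qed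
qed

lemma coset_left_mult_add:
  "a \<in> carrier R \<Longrightarrow> b \<in> carrier R \<Longrightarrow> x \<in> carrier F \<Longrightarrow>
   K #>\<^bsub>F\<^esub> left_mult (a \<oplus>\<^bsub>R\<^esub> b) x = K #>\<^bsub>F\<^esub> (left_mult a x + left_mult b x)"
  by (intro coset_eq left_mult_add_K left_mult_closed carrier_F_add R.a_closed)

lemma left_mult_mult:
  assumes "a \<in> carrier R" "b \<in> carrier R" "x \<in> carrier F"
  shows "left_mult a (left_mult b x) = left_mult (a \<otimes>\<^bsub>R\<^esub> b) x"
proof -
  have "Poly_Mapping.keys x \<subseteq> carrier R \<times> carrier V"
    using assms(3) by (simp add: carrier_free_Abelian_group_iff)
  then show ?thesis
    by (induction x rule: frag_induction) (use assms in \<open>auto simp: R.m_assoc frag_extend_diff\<close>)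
qed

lemma left_mult_one:
  assumes "x \<in> carrier F"
  shows "left_mult \<one>\<^bsub>R\<^esub> x = x"
proof -
  have "Poly_Mapping.keys x \<subseteq> carrier R \<times> carrier V"
    using assms by (simp add: carrier_free_Abelian_group_iff)
  then show ?thesis
    by (induction x rule: frag_induction) (auto simp: frag_extend_diff)
qed

theorem induced_is_left_module: "left_module R I"
proof -
  have "abelian_group I"
  proof (rule abelian_groupI)
    show "\<exists>y\<in>carrier I. y \<oplus>\<^bsub>I\<^esub> x = \<zero>\<^bsub>I\<^esub>" if x: "x \<in> carrier I" for x
    proof -
      obtain m where m: "m \<in> carrier F" "x = K #>\<^bsub>F\<^esub> m" using x by (auto simp: induced_carrier)
      have m': "- m \<in> carrier F" using m by (simp add: carrier_free_Abelian_group_iff)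
      then have "(K #>\<^bsub>F\<^esub> (- m)) \<oplus>\<^bsub>I\<^esub> x = \<zero>\<^bsub>I\<^esub>"
        using m by (simp add: induced_add induced_zero)
      then show ?thesis using m' by (auto simp: induced_carrier)
    qed
  qed (auto simp: induced_carrier induced_add induced_zero carrier_F_add ac_simps)
  then show ?thesis
    by (intro left_module.intro left_module_axioms.intro R.ring_axioms)
      (auto simp: induced_carrier induced_add induced_smult left_mult_closed carrier_F_add
        frag_extend_add left_mult_mult left_mult_one coset_left_mult_add)
qed

sublocale I: left_module R I by (rule induced_is_left_module)

lemma pure_def: "pure h v = K #>\<^bsub>F\<^esub> frag_of (h, v)"
  by (simp add: pure_tensor_def Let_def)

lemma pure_closed: "h \<in> carrier R \<Longrightarrow> v \<in> carrier V \<Longrightarrow> pure h v \<in> carrier I"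
  by (auto simp: pure_def induced_carrier)

lemma smult_pure:
  "a \<in> carrier R \<Longrightarrow> h \<in> carrier R \<Longrightarrow> v \<in> carrier V \<Longrightarrow> a \<odot>\<^bsub>I\<^esub> pure h v = pure (a \<otimes>\<^bsub>R\<^esub> h) v"
  by (simp add: pure_def induced_smult)

lemma pure_balanced:
  assumes "h \<in> carrier R" "a \<in> carrier A" "v \<in> carrier V"
  shows "pure (h \<otimes>\<^bsub>R\<^esub> a) v = pure h (a \<odot>\<^bsub>V\<^esub> v)"
proof -
  have "frag_of (h \<otimes>\<^bsub>R\<^esub> a, v) - frag_of (h, a \<odot>\<^bsub>V\<^esub> v) \<in> tensor_relations R A V"
    unfolding tensor_relations_def using assms by blast
  then show ?thesis unfolding pure_def using assms A_sub
    by (intro coset_eq generate.incl) (auto simp: V.smult_closed)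
qed

lemma induced_induct [consumes 1, case_names pure add minus]:
  assumes "x \<in> carrier I"
    and pure: "\<And>h v. h \<in> carrier R \<Longrightarrow> v \<in> carrier V \<Longrightarrow> P (pure h v)"
    and add: "\<And>x y. x \<in> carrier I \<Longrightarrow> y \<in> carrier I \<Longrightarrow> P x \<Longrightarrow> P y \<Longrightarrow> P (x \<oplus>\<^bsub>I\<^esub> y)"
    and minus: "\<And>x. x \<in> carrier I \<Longrightarrow> P x \<Longrightarrow> P (\<ominus>\<^bsub>I\<^esub> x)"
  shows "P x"
proof -
  have zero: "P \<zero>\<^bsub>I\<^esub>"
  proof -
    have p: "pure \<one>\<^bsub>R\<^esub> \<zero>\<^bsub>V\<^esub> \<in> carrier I" by (rule pure_closed) auto
    then have "P (pure \<one>\<^bsub>R\<^esub> \<zero>\<^bsub>V\<^esub> \<oplus>\<^bsub>I\<^esub> \<ominus>\<^bsub>I\<^esub> pure \<one>\<^bsub>R\<^esub> \<zero>\<^bsub>V\<^esub>)" by (intro add minus pure) auto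
    then show ?thesis using p by (simp add: I.M.r_neg)
  qed
  obtain y where y: "y \<in> carrier F" "x = K #>\<^bsub>F\<^esub> y" using assms(1) by (auto simp: induced_carrier)
  then have "Poly_Mapping.keys y \<subseteq> carrier R \<times> carrier V" by (simp add: carrier_free_Abelian_group_iff)
  then have "y \<in> carrier F \<and> P (K #>\<^bsub>F\<^esub> y)"
  proof (induction y rule: frag_induction)
    case zero
    then show ?case using \<open>P \<zero>\<^bsub>I\<^esub>\<close> by (simp add: induced_zero)
  next
    case (one p)
    then show ?case using pure by (auto simp: pure_def)
  next
    case (diff a b)
    then have cl: "K #>\<^bsub>F\<^esub> a \<in> carrier I" "K #>\<^bsub>F\<^esub> b \<in> carrier I" "K #>\<^bsub>F\<^esub> (a - b) \<in> carrier I"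
      by (auto simp: induced_carrier carrier_F_diff)
    have "(K #>\<^bsub>F\<^esub> (a - b)) \<oplus>\<^bsub>I\<^esub> (K #>\<^bsub>F\<^esub> b) = K #>\<^bsub>F\<^esub> a"
      using diff by (simp add: induced_add carrier_F_diff)
    then have "K #>\<^bsub>F\<^esub> (a - b) = (K #>\<^bsub>F\<^esub> a) \<oplus>\<^bsub>I\<^esub> \<ominus>\<^bsub>I\<^esub> (K #>\<^bsub>F\<^esub> b)"
      using cl by (metis I.M.a_assoc I.M.a_inv_closed I.M.r_neg I.M.r_zero)
    then show ?case using diff cl by (auto intro!: add minus carrier_F_diff)
  qed
  then show ?thesis using y by simp
qed

text \<open>A biadditive balanced map extends to the free abelian group on pairs and kills the relations.\<close>

theorem induced_universal:
  fixes \<beta> :: "'h \<Rightarrow> 'v \<Rightarrow> 'x::ab_group_add"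
  assumes add_l: "\<And>g h v. g \<in> carrier R \<Longrightarrow> h \<in> carrier R \<Longrightarrow> v \<in> carrier V \<Longrightarrow> \<beta> (g \<oplus>\<^bsub>R\<^esub> h) v = \<beta> g v + \<beta> h v"
    and add_r: "\<And>h v w. h \<in> carrier R \<Longrightarrow> v \<in> carrier V \<Longrightarrow> w \<in> carrier V \<Longrightarrow> \<beta> h (v \<oplus>\<^bsub>V\<^esub> w) = \<beta> h v + \<beta> h w"
    and bal: "\<And>h a v. h \<in> carrier R \<Longrightarrow> a \<in> carrier A \<Longrightarrow> v \<in> carrier V \<Longrightarrow> \<beta> (h \<otimes>\<^bsub>R\<^esub> a) v = \<beta> h (a \<odot>\<^bsub>V\<^esub> v)"
  obtains \<theta> where "\<And>x y. x \<in> carrier I \<Longrightarrow> y \<in> carrier I \<Longrightarrow> \<theta> (x \<oplus>\<^bsub>I\<^esub> y) = \<theta> x + \<theta> y"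
    and "\<And>h v. h \<in> carrier R \<Longrightarrow> v \<in> carrier V \<Longrightarrow> \<theta> (pure h v) = \<beta> h v"
proof -
  let ?G = "\<lparr>carrier = UNIV, monoid.mult = (+), one = (0::'x)\<rparr>"
  interpret G: comm_group ?G
    by (rule comm_groupI) (auto simp: ac_simps intro: exI[of _ "- _"])
  obtain \<phi> where \<phi>: "\<phi> \<in> hom F ?G" "\<And>p. p \<in> carrier R \<times> carrier V \<Longrightarrow> \<phi> (frag_of p) = case_prod \<beta> p"
    using G.free_Abelian_group_universal[of "case_prod \<beta>" "carrier R \<times> carrier V"] by auto
  interpret \<phi>: group_hom F ?G \<phi>
    using \<phi>(1) by (intro group_hom.intro group_hom_axioms.intro) auto
  have \<phi>_add: "\<phi> (x + y) = \<phi> x + \<phi> y" if "x \<in> carrier F" "y \<in> carrier F" for x y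
    using \<phi>.hom_mult[of x y] that by simp
  have \<phi>_diff: "\<phi> (x - y) = \<phi> x - \<phi> y" if "x \<in> carrier F" "y \<in> carrier F" for x y
    using \<phi>_add[of "x - y" y] that by (simp add: carrier_F_diff)
  have "tensor_relations R A V \<subseteq> kernel F ?G \<phi>"
  proof
    fix x assume x: "x \<in> tensor_relations R A V"
    then have "\<phi> x = 0"
      unfolding tensor_relations_def using A_sub V.smult_closed
      by (auto simp: \<phi>_diff \<phi>(2) carrier_F_diff add_l add_r bal subset_iff)
    then show "x \<in> kernel F ?G \<phi>" using x relations_sub by (auto simp: kernel_def)
  qed
  then have "K \<subseteq> kernel F ?G \<phi>"
    by (rule F.generate_subgroup_incl) (rule \<phi>.subgroup_kernel)
  then obtain \<theta> where \<theta>: "\<And>x. x \<in> carrier F \<Longrightarrow> \<theta> (K #>\<^bsub>F\<^esub> x) = \<phi> x"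
    using \<phi>.FactGroup_universal_kernel[OF K_normal] by metis
  show thesis
  proof
    show "\<theta> (x \<oplus>\<^bsub>I\<^esub> y) = \<theta> x + \<theta> y" if "x \<in> carrier I" "y \<in> carrier I" for x y
      using that by (auto simp: induced_carrier induced_add \<theta> \<phi>_add carrier_F_add)
    show "\<theta> (pure h v) = \<beta> h v" if "h \<in> carrier R" "v \<in> carrier V" for h v
      using that by (simp add: pure_def \<theta> \<phi>(2))
  qed
qed

end

section \<open>The Hecke algebra as a quotient of the free algebra\<close>

abbreviation free_ring :: "free_alg ring" where "free_ring \<equiv> ring_of_type_algebra"

lemma free_ring_simps:
  "carrier free_ring = UNIV" "x \<oplus>\<^bsub>free_ring\<^esub> y = x + y" "x \<otimes>\<^bsub>free_ring\<^esub> y = x * y"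
  "\<one>\<^bsub>free_ring\<^esub> = 1" "\<zero>\<^bsub>free_ring\<^esub> = 0"
  by (simp_all add: ring_of_type_algebra_def)

lemma ring_free_ring: "ring free_ring"
proof -
  have "\<exists>y. x + y = 0" "\<exists>y. y + x = 0" for x :: free_alg
    by (metis add.right_inverse, metis add.left_inverse)
  then show ?thesis unfolding ring_of_type_algebra_def
    by unfold_locales (auto simp: algebra_simps Units_def intro: exI[of _ "- _"])
qed

lemma ideal_hecke_ideal: "ideal (hecke_ideal q) free_ring"
  unfolding hecke_ideal_def by (rule ring.genideal_ideal[OF ring_free_ring]) (simp add: free_ring_simps)

lemma hecke_carrier: "carrier (hecke q) = range (hecke_class q)"
  by (auto simp: hecke_def FactRing_def A_RCOSETS_def' hecke_class_def free_ring_simps)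

lemma hecke_class_closed [simp]: "hecke_class q f \<in> carrier (hecke q)"
  by (simp add: hecke_carrier)

lemma hecke_class_add: "hecke_class q f \<oplus>\<^bsub>hecke q\<^esub> hecke_class q g = hecke_class q (f + g)"
  using ring_hom_add[OF ideal.rcos_ring_hom[OF ideal_hecke_ideal], of f g q]
  by (simp add: hecke_class_def hecke_def free_ring_simps)

lemma hecke_class_mult: "hecke_class q f \<otimes>\<^bsub>hecke q\<^esub> hecke_class q g = hecke_class q (f * g)"
  using ring_hom_mult[OF ideal.rcos_ring_hom[OF ideal_hecke_ideal], of f g q]
  by (simp add: hecke_class_def hecke_def free_ring_simps)

lemma hecke_class_one: "hecke_class q 1 = \<one>\<^bsub>hecke q\<^esub>"
  using ring_hom_one[OF ideal.rcos_ring_hom[OF ideal_hecke_ideal, of q]]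
  by (simp add: hecke_class_def hecke_def free_ring_simps)

lemma hecke_class_zero: "hecke_class q 0 = \<zero>\<^bsub>hecke q\<^esub>"
  using ring_hom_zero[OF ideal.rcos_ring_hom[OF ideal_hecke_ideal, of q] ring_free_ring] ring_hecke[of q]
  by (simp add: hecke_class_def hecke_def free_ring_simps)

lemma mem_hecke_class_iff: "f \<in> hecke_class q g \<longleftrightarrow> f - g \<in> hecke_ideal q"
proof -
  have "f \<in> hecke_class q g \<longleftrightarrow> (\<exists>h\<in>hecke_ideal q. f = h + g)"
    by (auto simp: hecke_class_def a_r_coset_def' free_ring_simps)
  also have "\<dots> \<longleftrightarrow> f - g \<in> hecke_ideal q" by (metis add_diff_cancel diff_add_cancel)
  finally show ?thesis .
qed

lemma hecke_class_eqI:
  assumes "f - g \<in> hecke_relations q"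
  shows "hecke_class q f = hecke_class q g"
proof -
  interpret I: ideal "hecke_ideal q" free_ring by (rule ideal_hecke_ideal)
  have "f - g \<in> hecke_ideal q"
    using ring.genideal_self[OF ring_free_ring, of "hecke_relations q"] assms
    by (auto simp: hecke_ideal_def free_ring_simps)
  then have "f \<in> hecke_ideal q +>\<^bsub>free_ring\<^esub> g"
    using mem_hecke_class_iff by (simp add: hecke_class_def)
  then show ?thesis
    unfolding hecke_class_def
    using I.a_repr_independence[OF _ _ I.a_subgroup, of f g] by (simp add: free_ring_simps)
qed

lemma poly_mapping_sum_induct [case_names single add]:
  fixes f :: "'a \<Rightarrow>\<^sub>0 'b::comm_monoid_add"
  assumes single: "\<And>w c. P (Poly_Mapping.single w c)" and add: "\<And>f g. P f \<Longrightarrow> P g \<Longrightarrow> P (f + g)"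
  shows "P f"
proof (induction f rule: update_induct)
  case const
  show ?case using single[of undefined 0] by simp
next
  case (update f a b)
  have "Poly_Mapping.update a b f = f + Poly_Mapping.single a b"
    using update(1) by (intro poly_mapping_eqI) (auto simp: lookup_update lookup_add lookup_single in_keys_iff when_def)
  then show ?case using add[OF update(3) single] by simp
qed

lemma free_word_Cons:
  "Poly_Mapping.single (g # w) c = Poly_Mapping.single [g] 1 * (Poly_Mapping.single w c :: free_alg)"
  by (simp add: mult_single plus_list_def)

lemma free_const_central: "free_const c * f = f * (free_const c :: free_alg)"
proof (induction f rule: poly_mapping_sum_induct)
  case (single w d)
  show ?case by (simp add: mult_single plus_list_def mult.commute)
qed (simp add: algebra_simps)

lemma free_const_one: "free_const 1 = 1"
  by (metis single_one zero_list_def)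

lemma hecke_const_one: "hecke_const q 1 = \<one>\<^bsub>hecke q\<^esub>"
  by (simp add: hecke_const_def hecke_class_one free_const_one)

lemma hecke_const_closed [simp]: "hecke_const q c \<in> carrier (hecke q)"
  and hecke_T_closed [simp]: "hecke_T q i \<in> carrier (hecke q)"
  and hecke_X_closed [simp]: "hecke_X q l \<in> carrier (hecke q)"
  by (simp_all add: hecke_const_def hecke_T_def hecke_X_def)

lemma hecke_const_zero: "hecke_const q 0 = \<zero>\<^bsub>hecke q\<^esub>"
  by (simp add: hecke_const_def hecke_class_zero)

lemma hecke_const_add: "hecke_const q c \<oplus>\<^bsub>hecke q\<^esub> hecke_const q d = hecke_const q (c + d)"
  by (simp add: hecke_const_def hecke_class_add single_add)

lemma hecke_const_mult: "hecke_const q c \<otimes>\<^bsub>hecke q\<^esub> hecke_const q d = hecke_const q (c * d)"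
  by (simp add: hecke_const_def hecke_class_mult mult_single plus_list_def)

lemma hecke_const_central:
  "a \<in> carrier (hecke q) \<Longrightarrow> a \<otimes>\<^bsub>hecke q\<^esub> hecke_const q c = hecke_const q c \<otimes>\<^bsub>hecke q\<^esub> a"
  by (auto simp: hecke_carrier hecke_const_def hecke_class_mult free_const_central)

text \<open>Every element is a sum of products of scalars and generators, so stability under these suffices.\<close>

lemma hecke_stable_subset:
  assumes M: "left_module (hecke q) M" and sub: "S \<subseteq> carrier M"
    and add: "\<And>x y. x \<in> S \<Longrightarrow> y \<in> S \<Longrightarrow> x \<oplus>\<^bsub>M\<^esub> y \<in> S"
    and const: "\<And>c x. x \<in> S \<Longrightarrow> hecke_const q c \<odot>\<^bsub>M\<^esub> x \<in> S"
    and T: "\<And>i x. x \<in> S \<Longrightarrow> hecke_T q i \<odot>\<^bsub>M\<^esub> x \<in> S"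
    and X: "\<And>l x. x \<in> S \<Longrightarrow> hecke_X q l \<odot>\<^bsub>M\<^esub> x \<in> S"
    and a: "a \<in> carrier (hecke q)" and x: "x \<in> S"
  shows "a \<odot>\<^bsub>M\<^esub> x \<in> S"
proof -
  interpret left_module "hecke q" M by fact
  have smult_class: "hecke_class q (f * g) \<odot>\<^bsub>M\<^esub> y = hecke_class q f \<odot>\<^bsub>M\<^esub> (hecke_class q g \<odot>\<^bsub>M\<^esub> y)"
    if "y \<in> S" for f g y
    using that sub by (subst smult_assoc[symmetric]) (auto simp: hecke_class_mult)
  have word: "hecke_class q (Poly_Mapping.single w c) \<odot>\<^bsub>M\<^esub> y \<in> S" if "y \<in> S" for w c y
    using that
  proof (induction w)
    case Nil
    then show ?case using const[of y c] by (simp add: hecke_const_def)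
  next
    case (Cons g w)
    then show ?case
      by (cases g) (subst free_word_Cons, use T X in \<open>simp add: smult_class hecke_T_def hecke_X_def\<close>)+
  qed
  obtain f where "a = hecke_class q f" using a by (auto simp: hecke_carrier)
  moreover have "hecke_class q f \<odot>\<^bsub>M\<^esub> x \<in> S"
  proof (induction f rule: poly_mapping_sum_induct)
    case (single w c)
    show ?case by (rule word[OF x])
  next
    case (add f g)
    have "hecke_class q (f + g) \<odot>\<^bsub>M\<^esub> x = hecke_class q f \<odot>\<^bsub>M\<^esub> x \<oplus>\<^bsub>M\<^esub> hecke_class q g \<odot>\<^bsub>M\<^esub> x"
      using x sub by (subst smult_l_distr[symmetric]) (auto simp: hecke_class_add)
    then show ?case using assms(3) add by simp
  qed
  ultimately show ?thesis by simp
qed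

text \<open>All later computations in modules use the relations of the algebra in the following form only.\<close>

locale hecke_module = left_module "hecke q" M
  for q and M :: "(hecke_elt, 'm, 's) module_scheme" (structure)
begin

lemma class_mult: "x \<in> carrier M \<Longrightarrow>
    hecke_class q (f * g) \<odot>\<^bsub>M\<^esub> x = hecke_class q f \<odot>\<^bsub>M\<^esub> (hecke_class q g \<odot>\<^bsub>M\<^esub> x)"
  by (subst smult_assoc[symmetric]) (auto simp: hecke_class_mult)

lemma class_add: "x \<in> carrier M \<Longrightarrow>
    hecke_class q (f + g) \<odot>\<^bsub>M\<^esub> x = hecke_class q f \<odot>\<^bsub>M\<^esub> x \<oplus>\<^bsub>M\<^esub> hecke_class q g \<odot>\<^bsub>M\<^esub> x"
  by (subst smult_l_distr[symmetric]) (auto simp: hecke_class_add)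

lemma const_const: "x \<in> carrier M \<Longrightarrow>
    hecke_const q c \<odot>\<^bsub>M\<^esub> (hecke_const q d \<odot>\<^bsub>M\<^esub> x) = hecke_const q (c * d) \<odot>\<^bsub>M\<^esub> x"
  by (subst smult_assoc[symmetric]) (auto simp: hecke_const_mult)

lemma const_add: "x \<in> carrier M \<Longrightarrow>
    hecke_const q (c + d) \<odot>\<^bsub>M\<^esub> x = hecke_const q c \<odot>\<^bsub>M\<^esub> x \<oplus>\<^bsub>M\<^esub> hecke_const q d \<odot>\<^bsub>M\<^esub> x"
  by (subst smult_l_distr[symmetric]) (auto simp: hecke_const_add)

lemma const_one: "x \<in> carrier M \<Longrightarrow> hecke_const q 1 \<odot>\<^bsub>M\<^esub> x = x"
  by (simp add: hecke_const_one smult_one)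

lemma const_zero: "x \<in> carrier M \<Longrightarrow> hecke_const q 0 \<odot>\<^bsub>M\<^esub> x = \<zero>\<^bsub>M\<^esub>"
  by (simp add: hecke_const_zero)

lemma const_commute: "a \<in> carrier (hecke q) \<Longrightarrow> x \<in> carrier M \<Longrightarrow>
    a \<odot>\<^bsub>M\<^esub> (hecke_const q c \<odot>\<^bsub>M\<^esub> x) = hecke_const q c \<odot>\<^bsub>M\<^esub> (a \<odot>\<^bsub>M\<^esub> x)"
  by (simp add: smult_assoc[symmetric] hecke_const_central)

lemma T_square: "x \<in> carrier M \<Longrightarrow>
    hecke_T q i \<odot>\<^bsub>M\<^esub> (hecke_T q i \<odot>\<^bsub>M\<^esub> x) = hecke_const q (q - inverse q) \<odot>\<^bsub>M\<^esub> (hecke_T q i \<odot>\<^bsub>M\<^esub> x) \<oplus>\<^bsub>M\<^esub> x"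
proof -
  assume x: "x \<in> carrier M"
  have "hecke_class q (free_T i * free_T i) = hecke_class q (free_const (q - inverse q) * free_T i + 1)"
    by (rule hecke_class_eqI) (auto simp: hecke_relations_def)
  then show ?thesis
    using x class_mult[OF x, of "free_T i" "free_T i"]
    by (simp add: class_add class_mult hecke_T_def hecke_const_def hecke_class_one smult_one)
qed

lemma braid: "x \<in> carrier M \<Longrightarrow>
    hecke_T q N1 \<odot>\<^bsub>M\<^esub> (hecke_T q N2 \<odot>\<^bsub>M\<^esub> (hecke_T q N1 \<odot>\<^bsub>M\<^esub> (hecke_T q N2 \<odot>\<^bsub>M\<^esub> (hecke_T q N1 \<odot>\<^bsub>M\<^esub> (hecke_T q N2 \<odot>\<^bsub>M\<^esub> x))))) =
    hecke_T q N2 \<odot>\<^bsub>M\<^esub> (hecke_T q N1 \<odot>\<^bsub>M\<^esub> (hecke_T q N2 \<odot>\<^bsub>M\<^esub> (hecke_T q N1 \<odot>\<^bsub>M\<^esub> (hecke_T q N2 \<odot>\<^bsub>M\<^esub> (hecke_T q N1 \<odot>\<^bsub>M\<^esub> x)))))"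
proof -
  assume x: "x \<in> carrier M"
  have "hecke_class q (free_T N1 * free_T N2 * free_T N1 * free_T N2 * free_T N1 * free_T N2)
      = hecke_class q (free_T N2 * free_T N1 * free_T N2 * free_T N1 * free_T N2 * free_T N1)"
    by (rule hecke_class_eqI) (simp add: hecke_relations_def)
  then have "hecke_class q (free_T N1 * free_T N2 * free_T N1 * free_T N2 * free_T N1 * free_T N2) \<odot>\<^bsub>M\<^esub> x
      = hecke_class q (free_T N2 * free_T N1 * free_T N2 * free_T N1 * free_T N2 * free_T N1) \<odot>\<^bsub>M\<^esub> x"
    by simp
  then show ?thesis
    using x by (simp only: class_mult smult_closed hecke_class_closed hecke_T_def)
qed

lemma bernstein: "x \<in> carrier M \<Longrightarrow>
    hecke_X q l \<odot>\<^bsub>M\<^esub> (hecke_T q i \<odot>\<^bsub>M\<^esub> x) = hecke_T q i \<odot>\<^bsub>M\<^esub> (hecke_X q (simple_refl i l) \<odot>\<^bsub>M\<^esub> x)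
      \<oplus>\<^bsub>M\<^esub> hecke_const q (q - inverse q) \<odot>\<^bsub>M\<^esub> (hecke_class q (demazure free_X i l) \<odot>\<^bsub>M\<^esub> x)"
proof -
  assume x: "x \<in> carrier M"
  have "hecke_class q (free_X l * free_T i)
      = hecke_class q (free_T i * free_X (simple_refl i l) + free_const (q - inverse q) * demazure free_X i l)"
    by (rule hecke_class_eqI) (unfold hecke_relations_def, blast)
  then have "hecke_class q (free_X l * free_T i) \<odot>\<^bsub>M\<^esub> x = hecke_class q (free_T i * free_X (simple_refl i l) + free_const (q - inverse q) * demazure free_X i l) \<odot>\<^bsub>M\<^esub> x"
    by simp
  then show ?thesis
    using x by (simp only: class_add class_mult hecke_T_def hecke_X_def hecke_const_def)
qed

end

section \<open>Modules from operators\<close>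

text \<open>Operators that satisfy the defining relations amount to a module: the action of the free algebra
by these operators kills the relations, hence the ideal that they generate. In this way a module
can be written down without any knowledge of the quotient ring.\<close>

locale hecke_operators = vector_space scl
  for scl :: "complex \<Rightarrow> 'x::ab_group_add \<Rightarrow> 'x" (infixr \<open>*v\<close> 75) +
  fixes q :: complex and gop :: "gen \<Rightarrow> 'x \<Rightarrow> 'x"
  assumes gop_add: "gop g (x + y) = gop g x + gop g y"
    and gop_scale: "gop g (c *v x) = c *v gop g x"
    and X_zero: "gop (GX 0) x = x"
    and X_add: "gop (GX l) (gop (GX m) x) = gop (GX (l + m)) x"
    and T_square: "gop (GT i) (gop (GT i) x) = (q - inverse q) *v gop (GT i) x + x"
    and braid: "gop (GT N1) (gop (GT N2) (gop (GT N1) (gop (GT N2) (gop (GT N1) (gop (GT N2) x)))))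
      = gop (GT N2) (gop (GT N1) (gop (GT N2) (gop (GT N1) (gop (GT N2) (gop (GT N1) x)))))"
    and bernstein: "gop (GX l) (gop (GT i) x) =
      gop (GT i) (gop (GX (simple_refl i l)) x) + (q - inverse q) *v demazure (\<lambda>m. gop (GX m) x) i l"
begin

definition free_act :: "free_alg \<Rightarrow> 'x \<Rightarrow> 'x" where
  "free_act f x = (\<Sum>w\<in>Poly_Mapping.keys f. Poly_Mapping.lookup f w *v foldr gop w x)"

lemma free_act_superset:
  "finite A \<Longrightarrow> Poly_Mapping.keys f \<subseteq> A \<Longrightarrow> free_act f x = (\<Sum>w\<in>A. Poly_Mapping.lookup f w *v foldr gop w x)"
  unfolding free_act_def by (rule sum.mono_neutral_left) (auto simp: in_keys_iff)

lemma free_act_plus: "free_act (f + g) x = free_act f x + free_act g x"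
proof -
  let ?A = "Poly_Mapping.keys f \<union> Poly_Mapping.keys g"
  have "free_act (f + g) x = (\<Sum>w\<in>?A. Poly_Mapping.lookup (f + g) w *v foldr gop w x)"
    by (rule free_act_superset) (auto dest: subsetD[OF Poly_Mapping.keys_add])
  also have "\<dots> = free_act f x + free_act g x"
    by (simp add: free_act_superset[of ?A] lookup_add scale_left_distrib sum.distrib)
  finally show ?thesis .
qed

lemma free_act_0 [simp]: "free_act 0 x = 0"
  by (simp add: free_act_def)

lemma free_act_minus: "free_act (f - g) x = free_act f x - free_act g x"
  using free_act_plus[of "f - g" g x] by simp

lemma free_act_uminus: "free_act (- f) x = - free_act f x"
  using free_act_minus[of 0 f x] by simp

lemma free_act_sum: "free_act (\<Sum>i\<in>A. f i) x = (\<Sum>i\<in>A. free_act (f i) x)"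
  by (induction A rule: infinite_finite_induct) (simp_all add: free_act_plus)

lemma free_act_single: "free_act (Poly_Mapping.single w c) x = c *v foldr gop w x"
  by (subst free_act_superset[of "{w}"]) auto

lemma foldr_gop_add: "foldr gop w (x + y) = foldr gop w x + foldr gop w y"
  by (induction w) (simp_all add: gop_add)

lemma foldr_gop_scale: "foldr gop w (c *v x) = c *v foldr gop w x"
  by (induction w) (simp_all add: gop_scale)

lemma free_act_add: "free_act f (x + y) = free_act f x + free_act f y"
  by (simp add: free_act_def foldr_gop_add scale_right_distrib sum.distrib)

lemma free_act_scale: "free_act f (c *v x) = c *v free_act f x"
  by (simp add: free_act_def foldr_gop_scale scale_sum_right mult.commute)

lemma free_act_mult: "free_act (f * g) x = free_act f (free_act g x)"
proof (induction f rule: poly_mapping_sum_induct)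
  case (single w c)
  show ?case
  proof (induction g rule: poly_mapping_sum_induct)
    case (single w' c')
    show ?case by (simp add: mult_single plus_list_def free_act_single foldr_gop_scale)
  qed (simp add: distrib_left free_act_plus free_act_add)
qed (simp add: distrib_right free_act_plus)

lemma free_act_demazure: "free_act (demazure free_X i l) x = demazure (\<lambda>m. gop (GX m) x) i l"
  by (simp add: demazure_def Let_def free_act_sum free_act_uminus free_act_single)

lemma free_act_one: "free_act 1 x = x"
  by (metis free_act_single foldr.simps(1) free_const_one id_apply scale_one)

lemma hecke_relations_act: "f \<in> hecke_relations q \<Longrightarrow> free_act f x = 0"
  unfolding hecke_relations_def
  by (auto simp: free_act_minus free_act_plus free_act_mult free_act_single free_act_one free_act_demazure
      X_zero X_add T_square braid bernstein simp flip: free_const_one)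

lemma hecke_ideal_act:
  assumes "f \<in> hecke_ideal q"
  shows "free_act f x = 0"
proof -
  have "ideal {f. \<forall>x. free_act f x = 0} free_ring"
  proof (rule idealI[OF ring_free_ring])
    have inv: "inv\<^bsub>add_monoid free_ring\<^esub> f = - f" for f
      by (rule group.inv_equality[OF abelian_group.a_group[OF ring.is_abelian_group[OF ring_free_ring]]])
        (simp_all add: free_ring_simps)
    show "subgroup {f. \<forall>x. free_act f x = 0} (add_monoid free_ring)"
    proof (rule subgroup.intro)
      fix f assume "f \<in> {f. \<forall>x. free_act f x = 0}"
      then show "inv\<^bsub>add_monoid free_ring\<^esub> f \<in> {f. \<forall>x. free_act f x = 0}"
        unfolding inv by (simp add: free_act_uminus)
    qed (auto simp: free_ring_simps free_act_plus)
  next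
    have zero: "free_act f 0 = 0" for f using free_act_add[of f 0 0] by simp
    fix a g assume "a \<in> {f. \<forall>x. free_act f x = 0}"
    then show "g \<otimes>\<^bsub>free_ring\<^esub> a \<in> {f. \<forall>x. free_act f x = 0}"
      and "a \<otimes>\<^bsub>free_ring\<^esub> g \<in> {f. \<forall>x. free_act f x = 0}"
      by (simp_all add: free_ring_simps free_act_mult zero)
  qed
  then have "hecke_ideal q \<subseteq> {f. \<forall>x. free_act f x = 0}"
    unfolding hecke_ideal_def
    by (rule ring.genideal_minimal[OF ring_free_ring]) (auto simp: hecke_relations_act)
  then show ?thesis using assms by auto
qed

text \<open>By \<open>hecke_ideal_act\<close> all representatives of a class act in the same way.\<close>

definition hecke_act :: "hecke_elt \<Rightarrow> 'x \<Rightarrow> 'x" where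
  "hecke_act a = free_act (SOME f. f \<in> a)"

lemma hecke_act_class: "hecke_act (hecke_class q f) x = free_act f x"
proof -
  have "f \<in> hecke_class q f"
    using additive_subgroup.zero_closed[OF ideal.axioms(1)[OF ideal_hecke_ideal]]
    by (simp add: mem_hecke_class_iff free_ring_simps)
  then have "(SOME g. g \<in> hecke_class q f) - f \<in> hecke_ideal q"
    by (metis mem_hecke_class_iff someI)
  from hecke_ideal_act[OF this, of x] show ?thesis
    by (simp add: hecke_act_def free_act_minus)
qed

lemma hecke_act_T: "hecke_act (hecke_T q i) x = gop (GT i) x"
  and hecke_act_X: "hecke_act (hecke_X q l) x = gop (GX l) x"
  and hecke_act_const: "hecke_act (hecke_const q c) x = c *v x"
  by (simp_all add: hecke_T_def hecke_X_def hecke_const_def hecke_act_class free_act_single)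

lemma hecke_act_one: "hecke_act \<one>\<^bsub>hecke q\<^esub> x = x"
  by (simp add: hecke_act_class free_act_one flip: hecke_class_one)

lemma hecke_act_plus: "a \<in> carrier (hecke q) \<Longrightarrow> b \<in> carrier (hecke q) \<Longrightarrow>
    hecke_act (a \<oplus>\<^bsub>hecke q\<^esub> b) x = hecke_act a x + hecke_act b x"
  by (auto simp: hecke_carrier hecke_class_add hecke_act_class free_act_plus)

lemma hecke_act_mult: "a \<in> carrier (hecke q) \<Longrightarrow> b \<in> carrier (hecke q) \<Longrightarrow>
    hecke_act (a \<otimes>\<^bsub>hecke q\<^esub> b) x = hecke_act a (hecke_act b x)"
  by (auto simp: hecke_carrier hecke_class_mult hecke_act_class free_act_mult)

lemma hecke_act_add: "hecke_act a (x + y) = hecke_act a x + hecke_act a y"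
  by (simp add: hecke_act_def free_act_add)

lemma hecke_act_scale: "hecke_act a (c *v x) = c *v hecke_act a x"
  by (simp add: hecke_act_def free_act_scale)

end

section \<open>A six-dimensional model\<close>

text \<open>Coordinates refer to a basis \<open>h\<^sub>0, h\<^sub>1, g\<^sub>0, g\<^sub>1, f\<^sub>1, f\<^sub>2\<close> of the module \<open>M\<close> for the root \<open>\<rho>\<close> that is
adapted to its generalized weight spaces: \<open>h\<^sub>0, h\<^sub>1\<close> have the weight \<open>t'\<close> with values \<open>\<rho>\<^bsup>-1\<^esup>, -1\<close> on the simple
roots, \<open>g\<^sub>0, g\<^sub>1\<close> the weight \<open>t = s\<^sub>1t'\<close> with values \<open>\<rho>, 1\<close>, and \<open>f\<^sub>1, f\<^sub>2\<close> the weights \<open>u\<^sub>1, u\<^sub>2\<close> with values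
\<open>-\<rho>\<^bsup>-1\<^esup>, -1\<close> and \<open>-\<rho>, -1\<close>.\<close>

type_synonym vec = "complex \<times> complex \<times> complex \<times> complex \<times> complex \<times> complex"

fun scale_vec :: "complex \<Rightarrow> vec \<Rightarrow> vec" where
  "scale_vec k (a, b, c, d, e, f) = (k * a, k * b, k * c, k * d, k * e, k * f)"

text \<open>The operators \<open>U\<^sub>i = q\<^bsup>-1\<^esup>T\<^sub>i\<close>. They no longer involve \<open>q\<close>: since \<open>q - q\<^bsup>-1\<^esup> = 2q\<close>, the quadratic relation reads
\<open>(U\<^sub>i - 1)\<^sup>2 = 0\<close>, and the commutation relation with \<open>X\<^bsup>l\<^esup>\<close> has the factor \<open>2\<close> in place of \<open>q - q\<^bsup>-1\<^esup>\<close>.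
That relation determines the matrices: a vector of weight \<open>u\<close> with \<open>u(\<alpha>\<^sub>i) \<noteq> 1\<close> is sent to \<open>2/(1 - u(\<alpha>\<^sub>i)\<^bsup>-1\<^esup>)\<close>
times itself plus a vector of weight \<open>s\<^sub>iu\<close>, and on a generalized weight space \<open>X\<^bsup>-\<alpha>\<^esup>\<close> with \<open>\<alpha> = \<alpha>\<^sub>i\<close> takes the place
of \<open>u(\<alpha>\<^sub>i)\<^bsup>-1\<^esup>\<close>. As \<open>t(\<alpha>\<^sub>2) = 1\<close>, the vector \<open>g\<^sub>1 = (U\<^sub>2 - 1)g\<^sub>0\<close> completes \<open>g\<^sub>0\<close> to a Jordan block. The components
of weights \<open>s\<^sub>1t'\<close>, \<open>s\<^sub>2t'\<close>, \<open>s\<^sub>1u\<^sub>1\<close> of \<open>U\<^sub>1h\<^sub>0\<close>, \<open>U\<^sub>1h\<^sub>1\<close>, \<open>U\<^sub>2h\<^sub>1\<close>, \<open>U\<^sub>1f\<^sub>1\<close> are normalized to be \<open>g\<^sub>0, g\<^sub>1, f\<^sub>1, f\<^sub>2\<close>;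
the remaining entries then follow from \<open>(U\<^sub>i - 1)\<^sup>2 = 0\<close>.\<close>

fun Uop :: "complex \<Rightarrow> node \<Rightarrow> vec \<Rightarrow> vec" where
  "Uop \<rho> N1 (a, b, c, d, e, f) =
    (2 * \<rho> * a + 4 * b + 3 * c + (8 - 16 * \<rho>) * d, 2 * \<rho> * b + 3 * d,
     a + (2 - 2 * \<rho>) * c - 4 * d, b + (2 - 2 * \<rho>) * d,
     (4 - 2 * \<rho>) / 3 * e + f / 3, e + (2 + 2 * \<rho>) / 3 * f)"
| "Uop \<rho> N2 (a, b, c, d, e, f) = (a - b, b, c, c + d, e + b, f)"

text \<open>The slope of the Jordan block on \<open>g\<^sub>0, g\<^sub>1\<close> at \<open>l\<close> is twice the pairing of \<open>l\<close> with \<open>\<alpha>\<^sub>2\<^sup>\<or>\<close>, as forced by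
\<open>g\<^sub>1 = (U\<^sub>2 - 1)g\<^sub>0\<close>; the slope on \<open>h\<^sub>0, h\<^sub>1\<close> at \<open>l\<close> is the same at \<open>s\<^sub>1l\<close>.\<close>

fun Xop :: "complex \<Rightarrow> lattice \<Rightarrow> vec \<Rightarrow> vec" where
  "Xop \<rho> (m, n) (a, b, c, d, e, f) =
    (let p = weight_at (inverse \<rho>) (-1) (m, n); t = weight_at \<rho> 1 (m, n) in
     (p * (a + 2 * of_int (m - n) * b), p * b, t * (c + 2 * of_int (2 * n - m) * d), t * d,
      weight_at (- inverse \<rho>) (-1) (m, n) * e, weight_at (- \<rho>) (-1) (m, n) * f))"

fun vec_op :: "complex \<Rightarrow> complex \<Rightarrow> gen \<Rightarrow> vec \<Rightarrow> vec" where
  "vec_op q \<rho> (GT i) x = scale_vec q (Uop \<rho> i x)"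
| "vec_op q \<rho> (GX l) x = Xop \<rho> l x"

lemma weight_at_add:
  "z \<noteq> 0 \<Longrightarrow> w \<noteq> 0 \<Longrightarrow> weight_at z w (l + m) = weight_at z w l * weight_at z w m"
  by (cases l; cases m) (simp add: weight_at_def power_int_add)

lemma vector_space_scale_vec: "vector_space scale_vec"
  by unfold_locales (auto simp: algebra_simps split: prod.splits)

interpretation scale_vec: vector_space scale_vec by (rule vector_space_scale_vec)

text \<open>The sum from \<open>0\<close> to \<open>k\<close> as an oriented sum, so that splitting at an intermediate point needs no
assumption on signs.\<close>

definition osum :: "(int \<Rightarrow> 'a::ab_group_add) \<Rightarrow> int \<Rightarrow> 'a" where
  "osum f k = (if 0 \<le> k then (\<Sum>j\<in>{0..<k}. f j) else - (\<Sum>j\<in>{k..<0}. f j))"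

lemma osum_0 [simp]: "osum f 0 = 0" by (simp add: osum_def)

lemma osum_Suc: "osum f (k + 1) = osum f k + f k"
proof -
  consider "k \<ge> 0" | "k = -1" | "k < -1" by linarith
  then show ?thesis
  proof cases
    case 1
    then have "{0..<k + 1} = insert k {0..<k}" by auto
    then show ?thesis using 1 by (simp add: osum_def)
  next
    case 2
    have "{-1..<0::int} = {-1}" by auto
    then show ?thesis using 2 by (simp add: osum_def)
  next
    case 3
    then have "{k..<0} = insert k {k + 1..<0}" by auto
    then show ?thesis using 3 by (simp add: osum_def)
  qed
qed

lemma osum_add: "osum f (k + m) = osum f k + osum (\<lambda>j. f (k + j)) m"
proof (induction m rule: int_induct[of _ 0])
  case (step1 i)
  then show ?case
    using osum_Suc[of f "k + i"] osum_Suc[of "\<lambda>j. f (k + j)" i] by (simp add: algebra_simps)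
next
  case (step2 i)
  then show ?case
    using osum_Suc[of f "k + i - 1"] osum_Suc[of "\<lambda>j. f (k + j)" "i - 1"] by (simp add: algebra_simps)
qed simp

lemma demazure_osum: "demazure e i l = osum (\<lambda>j. e (l - root_multiple j i)) (coroot_pairing l i)"
  by (simp add: demazure_def osum_def Let_def)

lemma coroot_pairing_add: "coroot_pairing (l + m) i = coroot_pairing l i + coroot_pairing m i"
  by (simp add: coroot_pairing_def algebra_simps)

lemma root_multiple_add: "root_multiple (j + k) i = root_multiple j i + root_multiple k i"
  by (simp add: root_multiple_def algebra_simps)

lemma simple_refl_add: "simple_refl i (l + m) = simple_refl i l + simple_refl i m"
  by (simp add: simple_refl_def coroot_pairing_add root_multiple_add)

text \<open>Writing \<open>\<partial>l\<close> for \<open>(X\<^bsup>l\<^esup> - X\<^bsup>sl\<^esup>)/(1 - X\<^bsup>-\<alpha>\<^esup>)\<close>, this is the twisted Leibniz rule \<open>\<partial>(l + m) = \<partial>l X\<^bsup>m\<^esup> + X\<^bsup>sl\<^esup> \<partial>m\<close>.\<close>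

lemma demazure_add:
  "demazure e i (l + m) =
    demazure (\<lambda>l'. e (l' + m)) i l + demazure (\<lambda>m'. e (simple_refl i l + m')) i m"
  by (simp add: demazure_osum coroot_pairing_add osum_add root_multiple_add simple_refl_def algebra_simps)

lemma demazure_additive:
  assumes "\<And>x y. h (x + y) = h x + h (y::'a::ab_group_add)"
  shows "demazure (\<lambda>m. h (e m)) i l = (h (demazure e i l) :: 'b::ab_group_add)"
proof -
  interpret additive h by unfold_locales (rule assms)
  show ?thesis by (simp add: demazure_def Let_def sum minus)
qed

text \<open>By the Leibniz rule the commutation relations between \<open>T\<^sub>i\<close> and \<open>X\<^bsup>l\<^esup>\<close> propagate to sums of lattice points,
so that finitely many of them imply all others.\<close>

lemma bernstein_relation_add:
  fixes e :: "lattice \<Rightarrow> 'x::ab_group_add \<Rightarrow> 'x"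
  assumes add: "\<And>l x y. e l (x + y) = e l x + e l y" and e_add: "\<And>l m x. e (l + m) x = e l (e m x)"
    and h: "\<And>l x. e l (h x) = h (e l x)" and h_add: "\<And>x y. h (x + y) = h x + h y"
    and l: "\<And>x. e l (T x) = T (e (simple_refl i l) x) + h (demazure (\<lambda>m. e m x) i l)"
    and m: "\<And>x. e m (T x) = T (e (simple_refl i m) x) + h (demazure (\<lambda>m. e m x) i m)"
  shows "e (l + m) (T x) = T (e (simple_refl i (l + m)) x) + h (demazure (\<lambda>m. e m x) i (l + m))"
proof -
  have comm: "e k (e k' x) = e k' (e k x)" for k k' x
    by (metis e_add add.commute)
  have "e (l + m) (T x) = e m (e l (T x))"
    by (metis e_add add.commute)
  also have "\<dots> = e m (T (e (simple_refl i l) x)) + h (e m (demazure (\<lambda>m. e m x) i l))"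
    by (simp add: l add h)
  also have "e m (demazure (\<lambda>m. e m x) i l) = demazure (\<lambda>l'. e (l' + m) x) i l"
    by (simp add: demazure_additive[of "e m", OF add, symmetric] e_add comm[of m])
  also have "demazure (\<lambda>m. e m (e (simple_refl i l) x)) i m
      = demazure (\<lambda>m'. e (simple_refl i l + m') x) i m"
    by (simp add: e_add comm[of _ "simple_refl i l"])
  ultimately show ?thesis
    by (simp add: m demazure_add[of _ i l m] h_add simple_refl_add e_add comm[of "simple_refl i m"])
qed

lemma lattice_induct:
  assumes "P (1, 0)" "P (-1, 0)" "P (0, 1)" "P (0, -1)"
    and add: "\<And>l m. P l \<Longrightarrow> P m \<Longrightarrow> P (l + m)"
  shows "P (l :: lattice)"
proof -
  have zero: "P (0, 0)" using add[OF assms(1,2)] by simp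
  have "P (a, 0)" for a
  proof (induction a rule: int_induct[of _ 0])
    case (step1 i)
    then show ?case using add[OF _ assms(1), of "(i, 0)"] by simp
  next
    case (step2 i)
    then show ?case using add[OF _ assms(2), of "(i, 0)"] by simp
  qed (rule zero)
  moreover have "P (0, b)" for b
  proof (induction b rule: int_induct[of _ 0])
    case (step1 i)
    then show ?case using add[OF _ assms(3), of "(0, i)"] by simp
  next
    case (step2 i)
    then show ?case using add[OF _ assms(4), of "(0, i)"] by simp
  qed (rule zero)
  ultimately show ?thesis using add[of "(fst l, 0)" "(0, snd l)"] by simp
qed

text \<open>The condition on \<open>\<rho>\<close> says that it is a primitive sixth root of unity.\<close>

locale sixth_root =
  fixes q \<rho> :: complex
  assumes q_square: "q ^ 2 = -1" and \<rho>_square: "\<rho> ^ 2 = \<rho> - 1"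
begin

lemma q_nz: "q \<noteq> 0" using q_square by auto
lemma q_mult: "q * q = -1" using q_square by (simp add: power2_eq_square)
lemma inverse_q: "inverse q = - q"
  using q_mult by (intro inverse_unique) simp
lemma \<rho>_nz: "\<rho> \<noteq> 0" using \<rho>_square by auto
lemma \<rho>_mult: "\<rho> * \<rho> = \<rho> - 1" using \<rho>_square by (simp add: power2_eq_square)
lemma \<rho>_mult': "\<rho> * (\<rho> * x) = \<rho> * x - x"
  by (simp add: \<rho>_mult mult.assoc[symmetric] left_diff_distrib)
lemma inverse_\<rho>: "inverse \<rho> = 1 - \<rho>"
  using \<rho>_mult by (intro inverse_unique) (simp add: algebra_simps)

lemma inverse_one_minus_\<rho>: "inverse (1 - \<rho>) = \<rho>" using inverse_\<rho> inverse_inverse_eq by metis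
lemma inverse_\<rho>_minus_one: "inverse (\<rho> - 1) = - \<rho>"
  using inverse_one_minus_\<rho> inverse_minus_eq[of "1 - \<rho>"] by simp

lemma U_add: "Uop \<rho> i (x + y) = Uop \<rho> i x + Uop \<rho> i y"
  by (cases i; cases x; cases y) (simp_all add: algebra_simps add_divide_distrib diff_divide_distrib)

lemma U_scale: "Uop \<rho> i (scale_vec k x) = scale_vec k (Uop \<rho> i x)"
  by (cases i; cases x) (simp_all add: algebra_simps add_divide_distrib diff_divide_distrib)

lemma Xop_add: "Xop \<rho> l (x + y) = Xop \<rho> l x + Xop \<rho> l y"
  by (cases l; cases x; cases y) (simp add: Let_def algebra_simps)

lemma Xop_scale: "Xop \<rho> l (scale_vec k x) = scale_vec k (Xop \<rho> l x)"
  by (cases l; cases x) (simp add: Let_def algebra_simps)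

lemma Xop_Xop: "Xop \<rho> (l + m) x = Xop \<rho> l (Xop \<rho> m x)"
  using \<rho>_nz weight_at_add[of _ _ l m]
  by (cases l; cases m; cases x) (simp add: Let_def algebra_simps)

lemma Xop_0: "Xop \<rho> 0 x = x"
  by (cases x) (simp add: Let_def weight_at_def zero_prod_def)

text \<open>These rules reduce polynomials in \<open>\<rho>\<close> to linear ones, so that the identities between the matrices of
the model hold by expansion.\<close>

lemmas \<rho>_normal_form = algebra_simps add_divide_distrib diff_divide_distrib \<rho>_mult \<rho>_mult'

lemma U_square: "Uop \<rho> i (Uop \<rho> i x) = scale_vec 2 (Uop \<rho> i x) - x"
  by (cases i; cases x) (simp_all add: \<rho>_normal_form)

lemma braid_U:
  "Uop \<rho> N1 (Uop \<rho> N2 (Uop \<rho> N1 (Uop \<rho> N2 (Uop \<rho> N1 (Uop \<rho> N2 x))))) = Uop \<rho> N2 (Uop \<rho> N1 (Uop \<rho> N2 (Uop \<rho> N1 (Uop \<rho> N2 (Uop \<rho> N1 x)))))"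
  by (cases x) (simp add: \<rho>_normal_form)

lemma bernstein_U:
  "Xop \<rho> l (Uop \<rho> i x) = Uop \<rho> i (Xop \<rho> (simple_refl i l) x) + scale_vec 2 (demazure (\<lambda>m. Xop \<rho> m x) i l)"
proof (induction l arbitrary: x rule: lattice_induct)
  have [simp]: "{-1..<0::int} = {-1}" "{0..<2::int} = {0, 1}" "{-2..<0::int} = {-2, -1}" "{0..<1::int} = {0}"
     "{0..<3::int} = {0, 1, 2}" "{-3..<0::int} = {-3, -2, -1}"
    by auto
  note [simp] = simple_refl_def coroot_pairing_def root_multiple_def demazure_def weight_at_def Let_def
    inverse_\<rho> power_int_minus inverse_one_minus_\<rho> inverse_\<rho>_minus_one power3_eq_cube power2_eq_square
  { case (1 x) show ?case
      by (cases i; cases x) (simp_all add: \<rho>_normal_form) }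
  { case (2 x) show ?case
      by (cases i; cases x) (simp_all add: \<rho>_normal_form) }
  { case (3 x) show ?case
      by (cases i; cases x) (simp_all add: \<rho>_normal_form) }
  { case (4 x) show ?case
      by (cases i; cases x) (simp_all add: \<rho>_normal_form) }
next
  case (5 l m x)
  show ?case
    by (rule bernstein_relation_add)
      (simp_all only: Xop_add Xop_Xop Xop_scale scale_vec.scale_right_distrib 5)
qed

sublocale hecke_operators scale_vec q "vec_op q \<rho>"
proof
  show "vec_op q \<rho> g (x + y) = vec_op q \<rho> g x + vec_op q \<rho> g y" for g x y
    by (cases g) (simp_all add: U_add Xop_add scale_vec.scale_right_distrib)
  show "vec_op q \<rho> g (scale_vec c x) = scale_vec c (vec_op q \<rho> g x)" for g c x
    by (cases g) (simp_all add: U_scale Xop_scale mult.commute)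
  show "vec_op q \<rho> (GT i) (vec_op q \<rho> (GT i) x) = scale_vec (q - inverse q) (vec_op q \<rho> (GT i) x) + x" for i x
    by (simp add: U_scale U_square scale_vec.scale_right_diff_distrib inverse_q q_mult algebra_simps)
  show "vec_op q \<rho> (GX l) (vec_op q \<rho> (GT i) x) = vec_op q \<rho> (GT i) (vec_op q \<rho> (GX (simple_refl i l)) x) +
       scale_vec (q - inverse q) (demazure (\<lambda>m. vec_op q \<rho> (GX m) x) i l)" for i l x
    by (simp add: Xop_scale bernstein_U scale_vec.scale_right_distrib inverse_q mult.commute)
qed (simp_all add: Xop_0 Xop_Xop U_scale braid_U)

end

context sixth_root begin

section \<open>Stable subspaces of the model\<close>

lemma \<rho>_nonreal: "\<rho> \<noteq> 1" "2 * \<rho> \<noteq> 1"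
proof -
  show "\<rho> \<noteq> 1" using \<rho>_mult by auto
  show "2 * \<rho> \<noteq> 1"
  proof
    assume "2 * \<rho> = 1"
    then have "2 * (2 * (\<rho> * \<rho>)) = 2 * \<rho>" by (simp add: mult.left_commute[of 2 \<rho>])
    then have "(2 * \<rho>) * 2 - 4 = 2 * \<rho>" by (simp add: \<rho>_mult algebra_simps)
    then show False using \<open>2 * \<rho> = 1\<close> by simp
  qed
qed

lemma Xop_\<alpha>1: "Xop \<rho> (1, 0) (a, b, c, d, e, f) =
    ((1 - \<rho>) * (a + 2 * b), (1 - \<rho>) * b, \<rho> * (c - 2 * d), \<rho> * d, (\<rho> - 1) * e, - \<rho> * f)"
  by (simp add: Let_def weight_at_def inverse_\<rho>)

lemma Xop_\<alpha>2: "Xop \<rho> (0, 1) (a, b, c, d, e, f) = (2 * b - a, - b, c + 4 * d, d, - e, - f)"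
  by (simp add: Let_def weight_at_def inverse_\<rho>)

text \<open>The eigenvalues \<open>1 - \<rho>, \<rho>, \<rho> - 1, -\<rho>\<close> of \<open>X\<^bsup>\<alpha>\<^esup>\<close> for \<open>\<alpha> = \<alpha>\<^sub>1\<close> on the four generalized weight spaces are
distinct, so this one operator already isolates the weight vectors.\<close>

lemma weight_vector_u1:
  "(\<forall>l. Xop \<rho> l x = scale_vec (weight_at (- inverse \<rho>) (-1) l) x) \<longleftrightarrow> (\<exists>e. x = (0, 0, 0, 0, e, 0))"
proof
  assume *: "\<forall>l. Xop \<rho> l x = scale_vec (weight_at (- inverse \<rho>) (-1) l) x"
  obtain a b c d e f where x: "x = (a, b, c, d, e, f)" by (cases x)
  have eq: "(1 - \<rho>) * (a + 2 * b) = (\<rho> - 1) * a \<and> (1 - \<rho>) * b = (\<rho> - 1) * b \<and>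
    \<rho> * (c - 2 * d) = (\<rho> - 1) * c \<and> \<rho> * d = (\<rho> - 1) * d \<and> - \<rho> * f = (\<rho> - 1) * f"
    using *[rule_format, of "(1, 0)"] unfolding x Xop_\<alpha>1 by (auto simp: weight_at_def inverse_\<rho>)
  have "2 * (1 - \<rho>) * b = 0" "d = 0" "(2 * \<rho> - 1) * f = 0"
    using eq by (simp_all add: algebra_simps)
  then have "b = 0" "d = 0" "f = 0" using \<rho>_nonreal by auto
  moreover from this have "2 * (1 - \<rho>) * a = 0" "c = 0" using eq by (auto simp: algebra_simps)
  ultimately show "\<exists>e. x = (0, 0, 0, 0, e, 0)" using \<rho>_nonreal x by simp
qed (auto simp: Let_def)

lemma weight_vector_u2:
  "(\<forall>l. Xop \<rho> l x = scale_vec (weight_at (- \<rho>) (-1) l) x) \<longleftrightarrow> (\<exists>f. x = (0, 0, 0, 0, 0, f))"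
proof
  assume *: "\<forall>l. Xop \<rho> l x = scale_vec (weight_at (- \<rho>) (-1) l) x"
  obtain a b c d e f where x: "x = (a, b, c, d, e, f)" by (cases x)
  have eq: "(1 - \<rho>) * (a + 2 * b) = - \<rho> * a \<and> (1 - \<rho>) * b = - \<rho> * b \<and>
    \<rho> * (c - 2 * d) = - \<rho> * c \<and> \<rho> * d = - \<rho> * d \<and> (\<rho> - 1) * e = - \<rho> * e"
    using *[rule_format, of "(1, 0)"] unfolding x Xop_\<alpha>1 by (auto simp: weight_at_def)
  have "b = 0" "2 * \<rho> * d = 0" "(2 * \<rho> - 1) * e = 0"
    using eq by (simp_all add: algebra_simps)
  then have "b = 0" "d = 0" "e = 0" using \<rho>_nonreal \<rho>_nz by auto
  moreover from this have "2 * \<rho> * c = 0" "a = 0" using eq by (auto simp: algebra_simps)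
  ultimately show "\<exists>f. x = (0, 0, 0, 0, 0, f)" using \<rho>_nz x by simp
qed (auto simp: Let_def)

text \<open>Submodules in coordinates; \<open>U\<^sub>i\<close> may replace \<open>T\<^sub>i\<close>, as these are proportional.\<close>

definition stable :: "vec set \<Rightarrow> bool" where
  "stable P \<longleftrightarrow> (\<forall>x\<in>P. \<forall>y\<in>P. x + y \<in> P) \<and> (\<forall>c. \<forall>x\<in>P. scale_vec c x \<in> P) \<and>
     (\<forall>i. \<forall>x\<in>P. Uop \<rho> i x \<in> P) \<and> (\<forall>l. \<forall>x\<in>P. Xop \<rho> l x \<in> P)"

lemma stable_lincomb: "stable P \<Longrightarrow> x \<in> P \<Longrightarrow> y \<in> P \<Longrightarrow> scale_vec c x + scale_vec d y \<in> P"
  by (simp add: stable_def)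

lemma stable_U: "stable P \<Longrightarrow> x \<in> P \<Longrightarrow> Uop \<rho> i x \<in> P"
  and stable_X: "stable P \<Longrightarrow> x \<in> P \<Longrightarrow> Xop \<rho> l x \<in> P"
  unfolding stable_def by blast+

lemma stable_generated_by_f1:
  assumes P: "stable P" and f1: "(0, 0, 0, 0, 1, 0) \<in> P"
  shows "(0, 0, 0, 0, e, f) \<in> P"
proof -
  note stable_U[OF P f1, of N1]
  from stable_lincomb[OF P this f1, of f "e - f * ((4 - 2 * \<rho>) / 3)"] show ?thesis by simp
qed

text \<open>Since \<open>f\<^sub>1\<close> and \<open>f\<^sub>2\<close> have different weights, one of them lies in the subspace, and \<open>U\<^sub>1\<close> sends each to a
vector with a nonzero component along the other.\<close>

lemma stable_simple_plane:
  assumes P: "stable P" and x: "(0, 0, 0, 0, e, f) \<in> P" and nz: "e \<noteq> 0 \<or> f \<noteq> 0"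
  shows "(0, 0, 0, 0, e', f') \<in> P"
proof (rule stable_generated_by_f1[OF P], cases "e = 0")
  case False
  note stable_X[OF P x, of "(1, 0)"]
  from stable_lincomb[OF P this x, of 1 \<rho>]
  have e: "(0, 0, 0, 0, (2 * \<rho> - 1) * e, 0) \<in> P"
    unfolding Xop_\<alpha>1 by (simp add: algebra_simps)
  from stable_lincomb[OF P e e, of "1 / ((2 * \<rho> - 1) * e)" 0]
  show "(0, 0, 0, 0, 1, 0) \<in> P" using False \<rho>_nonreal by simp
next
  case True
  then have "f \<noteq> 0" using nz by simp
  note stable_U[OF P x, of N1]
  from stable_lincomb[OF P this x, of 3 "- (2 + 2 * \<rho>)"]
  have f: "(0, 0, 0, 0, f, 0) \<in> P" using True by (simp add: algebra_simps add_divide_distrib)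
  from stable_lincomb[OF P f f, of "1 / f" 0]
  show "(0, 0, 0, 0, 1, 0) \<in> P" using \<open>f \<noteq> 0\<close> by simp
qed

text \<open>Applying \<open>U\<^sub>1, U\<^sub>2, U\<^sub>1, U\<^sub>2, U\<^sub>1\<close> in turn yields \<open>g\<^sub>0, g\<^sub>1, h\<^sub>1, f\<^sub>1, f\<^sub>2\<close>, up to vectors already obtained.\<close>

lemma stable_generated_by_h0:
  assumes P: "stable P" and h0: "(1, 0, 0, 0, 0, 0) \<in> P"
  shows "x \<in> P"
proof -
  note lc = stable_lincomb[OF P]
  note Uop = stable_U[OF P]
  have g0: "(0, 0, 1, 0, 0, 0) \<in> P" using lc[OF Uop[OF h0, of N1] h0, of 1 "- 2 * \<rho>"] by simp
  have g1: "(0, 0, 0, 1, 0, 0) \<in> P" using lc[OF Uop[OF g0, of N2] g0, of 1 "-1"] by simp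
  have "(0, 3, 0, 2 - 2 * \<rho>, 0, 0) \<in> P"
    using lc[OF lc[OF Uop[OF g1, of N1] h0, of 1 "16 * \<rho> - 8"] g0, of 1 4] by simp
  from lc[OF this g1, of "1 / 3" "- ((2 - 2 * \<rho>) / 3)"]
  have h1: "(0, 1, 0, 0, 0, 0) \<in> P" by simp
  have "(0, 0, 0, 0, 1, 0) \<in> P"
    using lc[OF lc[OF Uop[OF h1, of N2] h1, of 1 "-1"] h0, of 1 1] by simp
  then have S: "(0, 0, 0, 0, e, f) \<in> P" for e f by (rule stable_generated_by_f1[OF P])
  obtain a b c d e f where x: "x = (a, b, c, d, e, f)" by (cases x)
  have "scale_vec 1 (scale_vec a (1, 0, 0, 0, 0, 0) + scale_vec b (0, 1, 0, 0, 0, 0)) +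
      scale_vec 1 (scale_vec c (0, 0, 1, 0, 0, 0) + scale_vec d (0, 0, 0, 1, 0, 0)) \<in> P"
    by (intro lc h0 h1 g0 g1)
  from lc[OF this S[of e f], of 1 1] show ?thesis by (simp add: x)
qed

text \<open>Modulo the plane, \<open>X\<^bsup>\<alpha>\<^esup>\<close> for \<open>\<alpha> = \<alpha>\<^sub>2\<close> has the generalized eigenvalue \<open>-1\<close> on \<open>h\<^sub>0, h\<^sub>1\<close> and \<open>1\<close> on \<open>g\<^sub>0, g\<^sub>1\<close>, with one Jordan
block each. A suitable polynomial in it therefore sends the given vector to a nonzero multiple of
\<open>h\<^sub>0\<close> or \<open>g\<^sub>0\<close>, and \<open>U\<^sub>1g\<^sub>0\<close> has a nonzero component along \<open>h\<^sub>0\<close>.\<close>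

lemma stable_simple_quotient:
  assumes P: "stable P" and S: "\<And>e f. (0, 0, 0, 0, e, f) \<in> P"
    and x: "(a, b, c, d, e, f) \<in> P" and nz: "(a, b, c, d) \<noteq> (0, 0, 0, 0)"
  shows "y \<in> P"
proof (rule stable_generated_by_h0[OF P])
  note lc = stable_lincomb[OF P]
  note X = stable_X[OF P]
  have x0: "(a, b, c, d, 0, 0) \<in> P" using lc[OF x S[of "-e" "-f"], of 1 1] by simp
  (* X + 1 and then again X + 1 kill the h-block; X - 1 is nilpotent on the g-block. *)
  have x1: "(2 * b, 0, 2 * c + 4 * d, 2 * d, 0, 0) \<in> P"
    using lc[OF X[OF x0, of "(0, 1)"] x0, of 1 1] unfolding Xop_\<alpha>2 by simp
  have x2: "(0, 0, 4 * c + 16 * d, 4 * d, 0, 0) \<in> P"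
    using lc[OF X[OF x1, of "(0, 1)"] x1, of 1 1] unfolding Xop_\<alpha>2 by simp
  have x3: "(0, 0, 16 * d, 0, 0, 0) \<in> P"
    using lc[OF X[OF x2, of "(0, 1)"] x2, of 1 "-1"] unfolding Xop_\<alpha>2 by simp
  show "(1, 0, 0, 0, 0, 0) \<in> P"
  proof (cases "c = 0 \<and> d = 0")
    case False
    have g0: "(0, 0, 1, 0, 0, 0) \<in> P"
    proof (cases "d = 0")
      case True
      then show ?thesis using lc[OF x2 x2, of "1 / (4 * c)" 0] \<open>\<not> (c = 0 \<and> d = 0)\<close> by simp
    next
      case False
      then show ?thesis using lc[OF x3 x3, of "1 / (16 * d)" 0] by simp
    qed
    note stable_U[OF P g0, of N1]
    from lc[OF this g0, of "1 / 3" "- ((2 - 2 * \<rho>) / 3)"] show ?thesis by simp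
  next
    case True
    show ?thesis
    proof (cases "b = 0")
      case True
      then show ?thesis using lc[OF x0 x0, of "1 / a" 0] \<open>c = 0 \<and> d = 0\<close> nz by simp
    next
      case False
      then show ?thesis using lc[OF x1 x1, of "1 / (2 * b)" 0] \<open>c = 0 \<and> d = 0\<close> by simp
    qed
  qed
qed

lemma stable_submodule: "stable {(0, 0, 0, 0, e, f) | e f. True}"
proof -
  have "\<exists>e' f'. Uop \<rho> i (0, 0, 0, 0, e, f) = (0, 0, 0, 0, e', f')" for i e f by (cases i) simp_all
  moreover have "\<exists>e' f'. Xop \<rho> l (0, 0, 0, 0, e, f) = (0, 0, 0, 0, e', f')" for l e f
    by (cases l) (simp add: Let_def)
  ultimately show ?thesis by (auto simp: stable_def)
qed

end

section \<open>Modules isomorphic to the model\<close>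

context hecke_module begin

lemma const_minus_one: "x \<in> carrier M \<Longrightarrow> hecke_const q (-1) \<odot>\<^bsub>M\<^esub> x = \<ominus>\<^bsub>M\<^esub> x"
  using const_add[of x "-1" 1] by (intro M.minus_equality[symmetric]) (auto simp: const_zero const_one smult_closed)

lemma submoduleI_generators:
  assumes sub: "S \<subseteq> carrier M" and zero: "\<zero>\<^bsub>M\<^esub> \<in> S"
    and "\<And>x y. x \<in> S \<Longrightarrow> y \<in> S \<Longrightarrow> x \<oplus>\<^bsub>M\<^esub> y \<in> S"
    and "\<And>c x. x \<in> S \<Longrightarrow> hecke_const q c \<odot>\<^bsub>M\<^esub> x \<in> S"
    and "\<And>i x. x \<in> S \<Longrightarrow> hecke_T q i \<odot>\<^bsub>M\<^esub> x \<in> S"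
    and "\<And>l x. x \<in> S \<Longrightarrow> hecke_X q l \<odot>\<^bsub>M\<^esub> x \<in> S"
  shows "submodule S (hecke q) M"
  using hecke_stable_subset[OF left_module_axioms sub assms(3-6)] assms
  by (intro submoduleI) auto

end

text \<open>An isomorphism \<open>\<theta>\<close> of modules with the model; all assertions about \<open>M\<close> can then be checked in
coordinates.\<close>

locale hecke_model = sixth_root q \<rho> + hecke_module q M
  for q \<rho> :: complex and M :: "(hecke_elt, 'm) module" +
  fixes \<theta> :: "'m \<Rightarrow> vec"
  assumes bij: "bij_betw \<theta> (carrier M) UNIV"
    and \<theta>_add: "x \<in> carrier M \<Longrightarrow> y \<in> carrier M \<Longrightarrow> \<theta> (x \<oplus>\<^bsub>M\<^esub> y) = \<theta> x + \<theta> y"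
    and \<theta>_smult: "a \<in> carrier (hecke q) \<Longrightarrow> x \<in> carrier M \<Longrightarrow> \<theta> (a \<odot>\<^bsub>M\<^esub> x) = hecke_act a (\<theta> x)"
begin

lemma \<theta>_const: "x \<in> carrier M \<Longrightarrow> \<theta> (hecke_const q c \<odot>\<^bsub>M\<^esub> x) = scale_vec c (\<theta> x)"
  and \<theta>_T: "x \<in> carrier M \<Longrightarrow> \<theta> (hecke_T q i \<odot>\<^bsub>M\<^esub> x) = scale_vec q (Uop \<rho> i (\<theta> x))"
  and \<theta>_X: "x \<in> carrier M \<Longrightarrow> \<theta> (hecke_X q l \<odot>\<^bsub>M\<^esub> x) = Xop \<rho> l (\<theta> x)"
  by (simp_all add: \<theta>_smult hecke_act_const hecke_act_T hecke_act_X)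

lemma \<theta>_inject: "x \<in> carrier M \<Longrightarrow> y \<in> carrier M \<Longrightarrow> \<theta> x = \<theta> y \<longleftrightarrow> x = y"
  using bij by (auto simp: bij_betw_def inj_on_def)

lemma \<theta>_surj: obtains x where "x \<in> carrier M" "\<theta> x = y"
  using bij by (metis UNIV_I bij_betw_iff_bijections)

lemma \<theta>_zero: "\<theta> \<zero>\<^bsub>M\<^esub> = 0"
  using \<theta>_add[of "\<zero>\<^bsub>M\<^esub>" "\<zero>\<^bsub>M\<^esub>"] by simp

lemma \<theta>_eq_0: "x \<in> carrier M \<Longrightarrow> \<theta> x = 0 \<longleftrightarrow> x = \<zero>\<^bsub>M\<^esub>"
  using \<theta>_inject[of x "\<zero>\<^bsub>M\<^esub>"] by (simp add: \<theta>_zero)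

definition preimage :: "vec set \<Rightarrow> 'm set" where "preimage P = {x \<in> carrier M. \<theta> x \<in> P}"

lemma submodule_preimage:
  assumes P: "stable P" "0 \<in> P"
  shows "submodule (preimage P) (hecke q) M"
  by (rule submoduleI_generators)
    (use assms in \<open>auto simp: preimage_def smult_closed \<theta>_add \<theta>_const \<theta>_T \<theta>_X \<theta>_zero stable_def\<close>)

lemma stable_image:
  assumes S: "submodule S (hecke q) M"
  shows "stable (\<theta> ` S)"
proof -
  interpret S: submodule S "hecke q" M by fact
  have sub: "x \<in> carrier M" if "x \<in> S" for x using that S.subset by auto
  have sm: "a \<odot>\<^bsub>M\<^esub> x \<in> S" if "a \<in> carrier (hecke q)" "x \<in> S" for a x
    using S.smult_closed that by blast
  have add: "\<theta> x + \<theta> y \<in> \<theta> ` S" if "x \<in> S" "y \<in> S" for x y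
    using S.m_closed[of x y] that by (auto simp: sub \<theta>_add intro!: rev_image_eqI[of "x \<oplus>\<^bsub>M\<^esub> y"])
  have const: "scale_vec c (\<theta> x) \<in> \<theta> ` S" if "x \<in> S" for c x
    using sm[of "hecke_const q c" x] that by (intro rev_image_eqI[of "hecke_const q c \<odot>\<^bsub>M\<^esub> x"]) (auto simp: sub \<theta>_const)
  have X: "Xop \<rho> l (\<theta> x) \<in> \<theta> ` S" if "x \<in> S" for l x
    using sm[of "hecke_X q l" x] that by (intro rev_image_eqI[of "hecke_X q l \<odot>\<^bsub>M\<^esub> x"]) (auto simp: sub \<theta>_X)
  have Uop: "Uop \<rho> i (\<theta> x) \<in> \<theta> ` S" if "x \<in> S" for i x
  proof -
    have T: "hecke_T q i \<odot>\<^bsub>M\<^esub> x \<in> S" using sm that by simp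
    have Uop: "Uop \<rho> i (\<theta> x) = scale_vec (- q) (\<theta> (hecke_T q i \<odot>\<^bsub>M\<^esub> x))"
      using that by (simp add: sub \<theta>_T q_mult)
    show ?thesis unfolding Uop by (rule const[OF T])
  qed
  show ?thesis unfolding stable_def using add const Uop X by auto
qed

abbreviation "plane \<equiv> {(0, 0, 0, 0, e, f) | e f. True} :: vec set"

definition weight_plane :: "'m set" where "weight_plane = preimage plane"

lemma weight_space_iff:
  "x \<in> weight_space q M u \<longleftrightarrow> x \<in> carrier M \<and> (\<forall>l. Xop \<rho> l (\<theta> x) = scale_vec (u l) (\<theta> x))"
proof (cases "x \<in> carrier M")
  case True
  then have "hecke_X q l \<odot>\<^bsub>M\<^esub> x = hecke_const q (u l) \<odot>\<^bsub>M\<^esub> x \<longleftrightarrow> Xop \<rho> l (\<theta> x) = scale_vec (u l) (\<theta> x)" for l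
    by (subst \<theta>_inject[symmetric]) (simp_all add: smult_closed \<theta>_X \<theta>_const)
  then show ?thesis by (simp add: weight_space_def)
qed (simp add: weight_space_def)

text \<open>The two weight spaces are the lines through \<open>f\<^sub>1\<close> and \<open>f\<^sub>2\<close>.\<close>

lemma weight_spaces_sum:
  "weight_space q M (weight_at (- inverse \<rho>) (-1)) <+>\<^bsub>M\<^esub> weight_space q M (weight_at (- \<rho>) (-1)) = weight_plane"
    (is "?A <+>\<^bsub>M\<^esub> ?B = weight_plane")
proof (intro equalityI subsetI)
  fix z assume "z \<in> ?A <+>\<^bsub>M\<^esub> ?B"
  then obtain x y where z: "z = x \<oplus>\<^bsub>M\<^esub> y" "x \<in> ?A" "y \<in> ?B" by (auto simp: set_add_def')
  then obtain e f where "\<theta> x = (0, 0, 0, 0, e, 0)" "\<theta> y = (0, 0, 0, 0, 0, f)" "x \<in> carrier M" "y \<in> carrier M"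
    by (auto simp only: weight_space_iff weight_vector_u1 weight_vector_u2)
  then show "z \<in> weight_plane" by (simp add: weight_plane_def preimage_def z \<theta>_add)
next
  fix z assume z: "z \<in> weight_plane"
  then obtain e f where ef: "\<theta> z = (0, 0, 0, 0, e, f)" by (auto simp: weight_plane_def preimage_def)
  obtain x where x: "x \<in> carrier M" "\<theta> x = (0, 0, 0, 0, e, 0)" by (rule \<theta>_surj)
  obtain y where y: "y \<in> carrier M" "\<theta> y = (0, 0, 0, 0, 0, f)" by (rule \<theta>_surj)
  have "z = x \<oplus>\<^bsub>M\<^esub> y"
    using z x y ef by (subst \<theta>_inject[symmetric]) (auto simp: \<theta>_add weight_plane_def preimage_def)
  moreover have "x \<in> ?A" "y \<in> ?B"
    using x y by (simp_all only: weight_space_iff weight_vector_u1 weight_vector_u2 simp_thms) auto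
  ultimately show "z \<in> ?A <+>\<^bsub>M\<^esub> ?B" by (auto simp: set_add_def')
qed

lemma submodule_weight_plane: "submodule weight_plane (hecke q) M"
  unfolding weight_plane_def by (rule submodule_preimage[OF stable_submodule]) (simp add: zero_prod_def)

lemma irreducible_weight_plane: "irreducible_module (hecke q) (M\<lparr>carrier := weight_plane\<rparr>)"
proof (rule irreducible_moduleI)
  show "left_module (hecke q) (M\<lparr>carrier := weight_plane\<rparr>)" by (rule submodule_is_left_module[OF submodule_weight_plane])
  obtain x where "x \<in> carrier M" "\<theta> x = (0, 0, 0, 0, 1, 0)" by (rule \<theta>_surj)
  then have "x \<in> weight_plane" "x \<noteq> \<zero>\<^bsub>M\<^esub>" by (auto simp: weight_plane_def preimage_def \<theta>_zero zero_prod_def)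
  then show "carrier (M\<lparr>carrier := weight_plane\<rparr>) \<noteq> {\<zero>\<^bsub>M\<lparr>carrier := weight_plane\<rparr>\<^esub>}" by auto
next
  fix S x assume S: "submodule S (hecke q) (M\<lparr>carrier := weight_plane\<rparr>)" and x: "x \<in> S" "x \<noteq> \<zero>\<^bsub>M\<lparr>carrier := weight_plane\<rparr>\<^esub>"
  interpret S: submodule S "hecke q" "M\<lparr>carrier := weight_plane\<rparr>" by fact
  have WM: "weight_plane \<subseteq> carrier M" by (auto simp: weight_plane_def preimage_def)
  have SW: "S \<subseteq> weight_plane" using S.subset by simp
  have "submodule S (hecke q) M"
    by (rule submoduleI)
      (use SW WM S.one_closed S.m_closed S.smult_closed in auto)
  then have st: "stable (\<theta> ` S)" by (rule stable_image)
  obtain e f where ef: "\<theta> x = (0, 0, 0, 0, e, f)" using x SW by (auto simp: weight_plane_def preimage_def)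
  then have "e \<noteq> 0 \<or> f \<noteq> 0"
    using x SW WM \<theta>_eq_0[of x] by (auto simp: zero_prod_def)
  then have "plane \<subseteq> \<theta> ` S"
    using stable_simple_plane[OF st, of e f] x ef by force
  have "y \<in> S" if y: "y \<in> weight_plane" for y
  proof -
    have "\<theta> y \<in> \<theta> ` S" using y \<open>plane \<subseteq> \<theta> ` S\<close> by (auto simp only: weight_plane_def preimage_def)
    then obtain z where "z \<in> S" "\<theta> y = \<theta> z" by blast
    then show ?thesis using \<theta>_inject[of y z] y SW WM by (metis subsetD)
  qed
  then show "carrier (M\<lparr>carrier := weight_plane\<rparr>) \<subseteq> S" by auto
qed

lemma irreducible_quotient: "irreducible_module (hecke q) (quotient_module M weight_plane)"
proof -
  have Q: "submodule_quotient (hecke q) M weight_plane"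
    by (intro submodule_quotient.intro submodule_quotient_axioms.intro left_module_axioms submodule_weight_plane)
  show ?thesis
  proof (rule submodule_quotient.quotient_irreducible[OF Q])
    obtain x where x: "x \<in> carrier M" "\<theta> x = (1, 0, 0, 0, 0, 0)" by (rule \<theta>_surj)
    then have "x \<notin> weight_plane" by (simp add: weight_plane_def preimage_def)
    then show "weight_plane \<noteq> carrier M" using x by blast
  next
    fix P x assume P: "submodule P (hecke q) M" and weight_plane: "weight_plane \<subseteq> P" and x: "x \<in> P" "x \<notin> weight_plane"
    have PM: "P \<subseteq> carrier M" using subgroup.subset[OF submodule.axioms(1)[OF P]] by simp
    have plane: "(0, 0, 0, 0, e, f) \<in> \<theta> ` P" for e f
    proof -
      obtain y where y: "y \<in> carrier M" "\<theta> y = (0, 0, 0, 0, e, f)" by (rule \<theta>_surj)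
      then have "y \<in> weight_plane" by (simp add: weight_plane_def preimage_def)
      then show ?thesis using weight_plane y by (metis image_eqI subsetD)
    qed
    obtain a b c d e f where abcd: "\<theta> x = (a, b, c, d, e, f)" by (cases "\<theta> x")
    then have "(a, b, c, d) \<noteq> (0, 0, 0, 0)" using x PM by (auto simp: weight_plane_def preimage_def)
    moreover have "(a, b, c, d, e, f) \<in> \<theta> ` P" using x abcd by (metis image_eqI)
    ultimately have all: "y \<in> \<theta> ` P" for y
      using stable_simple_quotient[OF stable_image[OF P] plane] by blast
    show "carrier M \<subseteq> P"
    proof
      fix y assume y: "y \<in> carrier M"
      obtain z where "z \<in> P" "\<theta> y = \<theta> z" using all[of "\<theta> y"] by blast
      then show "y \<in> P" using \<theta>_inject[of y z] y PM by blast
    qed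
  qed
qed

lemma dim_weight_plane: "has_complex_dim q (M\<lparr>carrier := weight_plane\<rparr>) 2"
proof -
  obtain b1 where b1: "b1 \<in> carrier M" "\<theta> b1 = (0, 0, 0, 0, 1, 0)" by (rule \<theta>_surj)
  obtain b2 where b2: "b2 \<in> carrier M" "\<theta> b2 = (0, 0, 0, 0, 0, 1)" by (rule \<theta>_surj)
  have ne: "b1 \<noteq> b2" using b1 b2 by auto
  have weight_plane: "b1 \<in> weight_plane" "b2 \<in> weight_plane" "weight_plane \<subseteq> carrier M" using b1 b2 by (auto simp: weight_plane_def preimage_def)
  interpret weight_plane: left_module "hecke q" "M\<lparr>carrier := weight_plane\<rparr>" by (rule submodule_is_left_module[OF submodule_weight_plane])
  have closed: "hecke_const q k \<odot>\<^bsub>M\<^esub> x \<in> weight_plane" if "x \<in> weight_plane" for k x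
    using weight_plane.smult_closed[of "hecke_const q k" x] that by simp
  let ?sum = "\<lambda>c. \<Oplus>\<^bsub>M\<lparr>carrier := weight_plane\<rparr>\<^esub>b\<in>{b1, b2}. hecke_const q (c b) \<odot>\<^bsub>M\<lparr>carrier := weight_plane\<rparr>\<^esub> b"
  have sum: "?sum c = hecke_const q (c b1) \<odot>\<^bsub>M\<^esub> b1 \<oplus>\<^bsub>M\<^esub> hecke_const q (c b2) \<odot>\<^bsub>M\<^esub> b2" for c
  proof -
    have "?sum c = hecke_const q (c b1) \<odot>\<^bsub>M\<lparr>carrier := weight_plane\<rparr>\<^esub> b1 \<oplus>\<^bsub>M\<lparr>carrier := weight_plane\<rparr>\<^esub>
        (\<Oplus>\<^bsub>M\<lparr>carrier := weight_plane\<rparr>\<^esub>b\<in>{b2}. hecke_const q (c b) \<odot>\<^bsub>M\<lparr>carrier := weight_plane\<rparr>\<^esub> b)"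
      using ne weight_plane closed by (intro weight_plane.M.finsum_insert) auto
    also have "(\<Oplus>\<^bsub>M\<lparr>carrier := weight_plane\<rparr>\<^esub>b\<in>{b2}. hecke_const q (c b) \<odot>\<^bsub>M\<lparr>carrier := weight_plane\<rparr>\<^esub> b)
        = hecke_const q (c b2) \<odot>\<^bsub>M\<lparr>carrier := weight_plane\<rparr>\<^esub> b2 \<oplus>\<^bsub>M\<lparr>carrier := weight_plane\<rparr>\<^esub> \<zero>\<^bsub>M\<lparr>carrier := weight_plane\<rparr>\<^esub>"
      using weight_plane closed by (subst weight_plane.M.finsum_insert) auto
    finally show ?thesis using weight_plane closed[of b2 "c b2"] by (auto simp: subset_iff)
  qed
  have \<theta>_sum: "\<theta> (?sum c) = (0, 0, 0, 0, c b1, c b2)" for c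
    unfolding sum using b1 b2 by (simp add: \<theta>_add \<theta>_const smult_closed)
  have sum_closed: "?sum c \<in> carrier M" for c
    unfolding sum using b1 b2 by (simp add: smult_closed)
  have "\<exists>!c. c \<in> extensional {b1, b2} \<and> m = ?sum c" if m: "m \<in> weight_plane" for m
  proof -
    obtain e f where ef: "\<theta> m = (0, 0, 0, 0, e, f)" using m by (auto simp: weight_plane_def preimage_def)
    have "m = ?sum c \<longleftrightarrow> c b1 = e \<and> c b2 = f" for c
    proof -
      have "m = ?sum c \<longleftrightarrow> \<theta> m = \<theta> (?sum c)"
        using m weight_plane by (intro \<theta>_inject[OF _ sum_closed, symmetric]) blast
      also have "\<dots> \<longleftrightarrow> c b1 = e \<and> c b2 = f" unfolding \<theta>_sum ef by auto
      finally show ?thesis .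
    qed
    moreover have "\<exists>!c. c \<in> extensional {b1, b2} \<and> c b1 = e \<and> c b2 = f"
    proof (rule ex1I[of _ "restrict (\<lambda>b. if b = b1 then e else f) {b1, b2}"])
      fix c assume "c \<in> extensional {b1, b2} \<and> c b1 = e \<and> c b2 = f"
      then show "c = restrict (\<lambda>b. if b = b1 then e else f) {b1, b2}"
        using ne by (intro ext) (auto simp: extensional_def restrict_def)
    qed (use ne in auto)
    ultimately show ?thesis by simp
  qed
  moreover have "{b1, b2} \<subseteq> carrier (M\<lparr>carrier := weight_plane\<rparr>)" "finite {b1, b2}" "card {b1, b2} = 2"
    using weight_plane ne by auto
  ultimately show ?thesis unfolding has_complex_dim_def by (intro exI[of _ "{b1, b2}"]) simp
qed

end

section \<open>Linear spans in a module\<close>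

context hecke_module begin

lemma smult_finsum:
  "finite A \<Longrightarrow> a \<in> carrier (hecke q) \<Longrightarrow> f \<in> A \<rightarrow> carrier M \<Longrightarrow>
   a \<odot>\<^bsub>M\<^esub> (\<Oplus>\<^bsub>M\<^esub>i\<in>A. f i) = (\<Oplus>\<^bsub>M\<^esub>i\<in>A. a \<odot>\<^bsub>M\<^esub> f i)"
  by (induction A rule: finite_induct) (auto simp: M.finsum_insert smult_r_distr smult_closed Pi_def)

definition const_span :: "(nat \<Rightarrow> 'm) \<Rightarrow> nat \<Rightarrow> 'm set" where
  "const_span b n = range (\<lambda>c. \<Oplus>\<^bsub>M\<^esub>i\<in>{..<n}. hecke_const q (c i) \<odot>\<^bsub>M\<^esub> b i)"

context
  fixes b :: "nat \<Rightarrow> 'm" and n :: nat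
  assumes b_closed: "\<And>i. b i \<in> carrier M"
begin

lemma const_span_sub: "const_span b n \<subseteq> carrier M"
  by (auto simp: const_span_def b_closed smult_closed intro!: M.finsum_closed)

lemma const_span_memI:
  "x = (\<Oplus>\<^bsub>M\<^esub>i\<in>{..<n}. hecke_const q (c i) \<odot>\<^bsub>M\<^esub> b i) \<Longrightarrow> x \<in> const_span b n"
  unfolding const_span_def by (rule range_eqI[of _ _ c])

lemma const_span_const:
  assumes "x \<in> const_span b n"
  shows "hecke_const q k \<odot>\<^bsub>M\<^esub> x \<in> const_span b n"
proof -
  obtain c where "x = (\<Oplus>\<^bsub>M\<^esub>i\<in>{..<n}. hecke_const q (c i) \<odot>\<^bsub>M\<^esub> b i)"
    using assms by (auto simp: const_span_def)
  then have "hecke_const q k \<odot>\<^bsub>M\<^esub> x = (\<Oplus>\<^bsub>M\<^esub>i\<in>{..<n}. hecke_const q (k * c i) \<odot>\<^bsub>M\<^esub> b i)"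
    by (simp add: smult_finsum b_closed smult_closed const_const)
  then show ?thesis by (rule const_span_memI[of _ "\<lambda>i. k * c i"])
qed

lemma const_span_add:
  assumes "x \<in> const_span b n" "y \<in> const_span b n"
  shows "x \<oplus>\<^bsub>M\<^esub> y \<in> const_span b n"
proof -
  obtain c d where "x = (\<Oplus>\<^bsub>M\<^esub>i\<in>{..<n}. hecke_const q (c i) \<odot>\<^bsub>M\<^esub> b i)"
    "y = (\<Oplus>\<^bsub>M\<^esub>i\<in>{..<n}. hecke_const q (d i) \<odot>\<^bsub>M\<^esub> b i)"
    using assms by (auto simp: const_span_def)
  then have "x \<oplus>\<^bsub>M\<^esub> y = (\<Oplus>\<^bsub>M\<^esub>i\<in>{..<n}. hecke_const q (c i + d i) \<odot>\<^bsub>M\<^esub> b i)"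
    by (simp add: M.finsum_addf b_closed smult_closed const_add)
  then show ?thesis by (rule const_span_memI[of _ "\<lambda>i. c i + d i"])
qed

lemma const_span_zero: "\<zero>\<^bsub>M\<^esub> \<in> const_span b n"
proof -
  have "(\<Oplus>\<^bsub>M\<^esub>i\<in>{..<n}. hecke_const q 0 \<odot>\<^bsub>M\<^esub> b i) = \<zero>\<^bsub>M\<^esub>"
    by (simp add: const_zero b_closed)
  then show ?thesis by (intro const_span_memI[of _ "\<lambda>_. 0"]) simp
qed

lemma const_span_base:
  assumes "i < n"
  shows "b i \<in> const_span b n"
proof -
  have "(\<Oplus>\<^bsub>M\<^esub>j\<in>{..<n}. hecke_const q (if i = j then 1 else 0) \<odot>\<^bsub>M\<^esub> b j)
      = (\<Oplus>\<^bsub>M\<^esub>j\<in>{..<n}. if i = j then b j else \<zero>\<^bsub>M\<^esub>)"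
    by (rule M.finsum_cong') (auto simp: const_one const_zero b_closed)
  also have "\<dots> = b i" using assms by (intro M.finsum_singleton) (auto simp: b_closed)
  finally have "b i = (\<Oplus>\<^bsub>M\<^esub>j\<in>{..<n}. hecke_const q (if i = j then 1 else 0) \<odot>\<^bsub>M\<^esub> b j)" by (rule sym)
  then show ?thesis by (rule const_span_memI[of _ "\<lambda>j. if i = j then 1 else 0"])
qed

lemma const_span_smult:
  assumes a: "a \<in> carrier (hecke q)" and ab: "\<And>i. i < n \<Longrightarrow> a \<odot>\<^bsub>M\<^esub> b i \<in> const_span b n"
    and x: "x \<in> const_span b n"
  shows "a \<odot>\<^bsub>M\<^esub> x \<in> const_span b n"
proof -
  have sum: "(\<Oplus>\<^bsub>M\<^esub>i\<in>A. g i) \<in> const_span b n" if "finite A" "\<And>i. i \<in> A \<Longrightarrow> g i \<in> const_span b n" for A :: "nat set" and g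
    using that
  proof (induction A rule: finite_induct)
    case (insert i A)
    have "(\<Oplus>\<^bsub>M\<^esub>i\<in>insert i A. g i) = g i \<oplus>\<^bsub>M\<^esub> (\<Oplus>\<^bsub>M\<^esub>i\<in>A. g i)"
      using insert const_span_sub by (intro M.finsum_insert) auto
    then show ?case using insert by (simp add: const_span_add)
  qed (simp add: const_span_zero)
  obtain c where "x = (\<Oplus>\<^bsub>M\<^esub>i\<in>{..<n}. hecke_const q (c i) \<odot>\<^bsub>M\<^esub> b i)"
    using x by (auto simp: const_span_def)
  then have "a \<odot>\<^bsub>M\<^esub> x = (\<Oplus>\<^bsub>M\<^esub>i\<in>{..<n}. hecke_const q (c i) \<odot>\<^bsub>M\<^esub> (a \<odot>\<^bsub>M\<^esub> b i))"
    using a by (simp add: smult_finsum b_closed smult_closed const_commute)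
  also have "\<dots> \<in> const_span b n" using ab by (intro sum const_span_const) auto
  finally show ?thesis .
qed

text \<open>Commuting \<open>X\<^bsup>l\<^esup>\<close> past \<open>T\<^sub>i\<close> leaves only terms in which \<open>X\<close> acts on \<open>x\<close> first. So stability of the span under \<open>X\<close>
propagates along a basis obtained by applying the \<open>T\<^sub>i\<close>.\<close>

lemma const_span_X:
  assumes T: "\<And>i x. x \<in> const_span b n \<Longrightarrow> hecke_T q i \<odot>\<^bsub>M\<^esub> x \<in> const_span b n"
    and x: "x \<in> const_span b n" and X: "\<And>l. hecke_X q l \<odot>\<^bsub>M\<^esub> x \<in> const_span b n"
  shows "hecke_X q l \<odot>\<^bsub>M\<^esub> (hecke_T q i \<odot>\<^bsub>M\<^esub> x) \<in> const_span b n"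
proof -
  let ?S = "const_span b n"
  have xM: "x \<in> carrier M" using x const_span_sub by auto
  have free: "hecke_class q (free_X m) \<odot>\<^bsub>M\<^esub> x \<in> ?S" for m
    using X by (simp add: hecke_X_def)
  have sum: "hecke_class q (\<Sum>j\<in>A. free_X (g j)) \<odot>\<^bsub>M\<^esub> x \<in> ?S" if "finite A" for A :: "int set" and g
    using that
    by (induction A rule: finite_induct)
      (simp_all add: hecke_class_zero xM class_add const_span_zero const_span_add free)
  have uminus: "hecke_class q (- f) \<odot>\<^bsub>M\<^esub> x \<in> ?S" if "hecke_class q f \<odot>\<^bsub>M\<^esub> x \<in> ?S" for f
  proof -
    have "- f = free_const (-1) * f"
      by (metis single_uminus free_const_one mult_minus1)
    then show ?thesis using const_span_const[OF that, of "-1"] by (simp add: class_mult xM hecke_const_def)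
  qed
  have "hecke_class q (demazure free_X i l) \<odot>\<^bsub>M\<^esub> x \<in> ?S"
    unfolding demazure_def Let_def by (auto intro!: sum uminus)
  then show ?thesis
    unfolding bernstein[OF xM] by (intro const_span_add T const_span_const X)
qed

end

end

section \<open>The induced module\<close>

text \<open>Here \<open>\<rho>\<close> is \<open>r\<close> for \<open>M\<close> and \<open>r\<^bsup>-1\<^esup>\<close> for \<open>N\<close>; since \<open>-q\<^bsup>-1\<^esup> = q\<close>, the operator \<open>T\<^sub>2\<close> acts by \<open>q\<close> in both cases.\<close>

locale line_induction = sixth_root q \<rho>
  for q \<rho> :: complex +
  fixes V :: "(hecke_elt, 'v) module" and v :: 'v
  assumes line: "parabolic_line q N2 q (weight_at (inverse \<rho>) (-1)) V v"
begin

abbreviation "A \<equiv> hecke_parabolic q N2"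
abbreviation "M \<equiv> induced_module (hecke q) A V"

sublocale R: ring "hecke q" by (rule ring_hecke)

lemma A_sub: "carrier A \<subseteq> carrier (hecke q)"
  unfolding hecke_parabolic_def by (auto dest: R.generate_ring_in_carrier[rotated])

lemma A_generators: "hecke_T q N2 \<in> carrier A" "hecke_X q l \<in> carrier A" "hecke_const q c \<in> carrier A"
  unfolding hecke_parabolic_def by (auto intro: generate_ring.incl)

lemma A_simps: "x \<oplus>\<^bsub>A\<^esub> y = x \<oplus>\<^bsub>hecke q\<^esub> y" "x \<otimes>\<^bsub>A\<^esub> y = x \<otimes>\<^bsub>hecke q\<^esub> y"
  "\<one>\<^bsub>A\<^esub> = \<one>\<^bsub>hecke q\<^esub>" "\<zero>\<^bsub>A\<^esub> = \<zero>\<^bsub>hecke q\<^esub>"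
  by (simp_all add: hecke_parabolic_def)

sublocale induction_data "hecke q" A V
  using line A_sub ring_hecke unfolding parabolic_line_def induction_data_def induction_data_axioms_def by blast

sublocale M: hecke_module q M by (intro hecke_module.intro induced_is_left_module)

lemma v: "v \<in> carrier V" "v \<noteq> \<zero>\<^bsub>V\<^esub>"
  and V_line: "carrier V = range (\<lambda>z. hecke_const q z \<odot>\<^bsub>V\<^esub> v)"
  and T_v: "hecke_T q N2 \<odot>\<^bsub>V\<^esub> v = hecke_const q q \<odot>\<^bsub>V\<^esub> v"
  and X_v: "hecke_X q l \<odot>\<^bsub>V\<^esub> v = hecke_const q (weight_at (inverse \<rho>) (-1) l) \<odot>\<^bsub>V\<^esub> v"
  using line unfolding parabolic_line_def by blast+

lemma V_const_const: "w \<in> carrier V \<Longrightarrow>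
    hecke_const q c \<odot>\<^bsub>V\<^esub> (hecke_const q d \<odot>\<^bsub>V\<^esub> w) = hecke_const q (c * d) \<odot>\<^bsub>V\<^esub> w"
  by (simp add: V.smult_assoc[symmetric] A_generators A_simps hecke_const_mult)

lemma V_const_add: "w \<in> carrier V \<Longrightarrow>
    hecke_const q (c + d) \<odot>\<^bsub>V\<^esub> w = hecke_const q c \<odot>\<^bsub>V\<^esub> w \<oplus>\<^bsub>V\<^esub> hecke_const q d \<odot>\<^bsub>V\<^esub> w"
  by (simp add: V.smult_l_distr[symmetric] A_generators A_simps hecke_const_add)

lemma V_const_one: "w \<in> carrier V \<Longrightarrow> hecke_const q 1 \<odot>\<^bsub>V\<^esub> w = w"
  using V.smult_one[of w] by (simp add: A_simps hecke_const_one)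

lemma V_const_closed: "w \<in> carrier V \<Longrightarrow> hecke_const q c \<odot>\<^bsub>V\<^esub> w \<in> carrier V"
  by (simp add: V.smult_closed A_generators)

lemma V_const_inject:
  assumes "hecke_const q c \<odot>\<^bsub>V\<^esub> v = hecke_const q d \<odot>\<^bsub>V\<^esub> v"
  shows "c = d"
proof (rule ccontr)
  assume "c \<noteq> d"
  have "hecke_const q (c - d) \<odot>\<^bsub>V\<^esub> v \<oplus>\<^bsub>V\<^esub> hecke_const q d \<odot>\<^bsub>V\<^esub> v = \<zero>\<^bsub>V\<^esub> \<oplus>\<^bsub>V\<^esub> hecke_const q d \<odot>\<^bsub>V\<^esub> v"
    using v assms by (simp add: V_const_add[symmetric] V_const_closed)
  then have "hecke_const q (c - d) \<odot>\<^bsub>V\<^esub> v = \<zero>\<^bsub>V\<^esub>"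
    using v by (subst (asm) V.M.add.r_cancel) (auto simp: V_const_closed)
  then have "hecke_const q (inverse (c - d)) \<odot>\<^bsub>V\<^esub> (hecke_const q (c - d) \<odot>\<^bsub>V\<^esub> v) = \<zero>\<^bsub>V\<^esub>"
    by (simp add: A_generators)
  then show False using v \<open>c \<noteq> d\<close> by (simp add: V_const_const V_const_one)
qed

definition coeff :: "'v \<Rightarrow> complex" where "coeff w = (THE c. w = hecke_const q c \<odot>\<^bsub>V\<^esub> v)"

lemma coeff_const: "coeff (hecke_const q c \<odot>\<^bsub>V\<^esub> v) = c"
  unfolding coeff_def by (rule the_equality) (auto dest: V_const_inject)

lemma coeff: "w \<in> carrier V \<Longrightarrow> hecke_const q (coeff w) \<odot>\<^bsub>V\<^esub> v = w"
  by (auto simp: V_line coeff_const)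

lemma coeff_add: "w \<in> carrier V \<Longrightarrow> w' \<in> carrier V \<Longrightarrow> coeff (w \<oplus>\<^bsub>V\<^esub> w') = coeff w + coeff w'"
  using coeff_const[of "coeff w + coeff w'"] v by (simp add: V_const_add coeff)

abbreviation "h\<^sub>0 \<equiv> (1, 0, 0, 0, 0, 0) :: vec"

text \<open>The parabolic subalgebra acts on \<open>v\<close> and on \<open>h\<^sub>0\<close> through the same character, which makes the map
\<open>(h, cv) \<mapsto> h(ch\<^sub>0)\<close> balanced.\<close>

lemma parabolic_scalar:
  assumes "a \<in> carrier A"
  obtains z where "a \<odot>\<^bsub>V\<^esub> v = hecke_const q z \<odot>\<^bsub>V\<^esub> v" "hecke_act a h\<^sub>0 = scale_vec z h\<^sub>0"
proof -
  have "a \<in> generate_ring (hecke q) (insert (hecke_T q N2) (range (hecke_X q) \<union> range (hecke_const q)))"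
    using assms by (simp add: hecke_parabolic_def)
  then have "a \<in> carrier A \<and> (\<exists>z. a \<odot>\<^bsub>V\<^esub> v = hecke_const q z \<odot>\<^bsub>V\<^esub> v \<and> hecke_act a h\<^sub>0 = scale_vec z h\<^sub>0)"
  proof (induction rule: generate_ring.induct)
    case one
    have "\<one>\<^bsub>hecke q\<^esub> \<odot>\<^bsub>V\<^esub> v = hecke_const q 1 \<odot>\<^bsub>V\<^esub> v" by (simp add: hecke_const_one)
    moreover have "hecke_act \<one>\<^bsub>hecke q\<^esub> h\<^sub>0 = scale_vec 1 h\<^sub>0" by (simp add: hecke_act_one)
    moreover have "\<one>\<^bsub>hecke q\<^esub> \<in> carrier A" using A_generators(3)[of 1] by (simp add: hecke_const_one)
    ultimately show ?case by blast
  next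
    case (incl h)
    then consider "h = hecke_T q N2" | l where "h = hecke_X q l" | c where "h = hecke_const q c" by auto
    then show ?case
    proof cases
      case 1
      have "hecke_act (hecke_T q N2) h\<^sub>0 = scale_vec q h\<^sub>0" by (simp add: hecke_act_T)
      then show ?thesis using 1 T_v A_generators by blast
    next
      case (2 l)
      have "hecke_act (hecke_X q l) h\<^sub>0 = scale_vec (weight_at (inverse \<rho>) (-1) l) h\<^sub>0"
        by (cases l) (simp add: hecke_act_X Let_def)
      then show ?thesis using 2 X_v A_generators by blast
    next
      case (3 c)
      have "hecke_act (hecke_const q c) h\<^sub>0 = scale_vec c h\<^sub>0" by (simp add: hecke_act_const)
      then show ?thesis using 3 A_generators by blast
    qed
  next
    case (a_inv h)
    then obtain z where z: "h \<in> carrier A" "h \<odot>\<^bsub>V\<^esub> v = hecke_const q z \<odot>\<^bsub>V\<^esub> v" "hecke_act h h\<^sub>0 = scale_vec z h\<^sub>0"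
      by blast
    have hR: "h \<in> carrier (hecke q)" using z A_sub by auto
    have "hecke_const q (-1) \<otimes>\<^bsub>hecke q\<^esub> h \<oplus>\<^bsub>hecke q\<^esub> \<one>\<^bsub>hecke q\<^esub> \<otimes>\<^bsub>hecke q\<^esub> h = \<zero>\<^bsub>hecke q\<^esub>"
      using hR by (simp add: R.l_distr[symmetric] hecke_const_add hecke_const_zero del: R.l_one flip: hecke_const_one)
    then have minus: "\<ominus>\<^bsub>hecke q\<^esub> h = hecke_const q (-1) \<otimes>\<^bsub>hecke q\<^esub> h"
      using hR by (intro R.minus_equality) simp_all
    have "hecke_const q (-1) \<otimes>\<^bsub>A\<^esub> h \<in> carrier A"
      using z(1) A_generators by (intro V.R.m_closed) auto
    moreover have "(hecke_const q (-1) \<otimes>\<^bsub>A\<^esub> h) \<odot>\<^bsub>V\<^esub> v = hecke_const q (-z) \<odot>\<^bsub>V\<^esub> v"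
      using z v A_generators by (simp add: V.smult_assoc V_const_const)
    moreover have "hecke_act (hecke_const q (-1) \<otimes>\<^bsub>hecke q\<^esub> h) h\<^sub>0 = scale_vec (-z) h\<^sub>0"
      using z hR by (simp add: hecke_act_mult hecke_act_const)
    ultimately show ?case unfolding minus A_simps by blast
  next
    case (eng_add a b)
    then obtain z z' where z: "a \<in> carrier A" "a \<odot>\<^bsub>V\<^esub> v = hecke_const q z \<odot>\<^bsub>V\<^esub> v" "hecke_act a h\<^sub>0 = scale_vec z h\<^sub>0"
      "b \<in> carrier A" "b \<odot>\<^bsub>V\<^esub> v = hecke_const q z' \<odot>\<^bsub>V\<^esub> v" "hecke_act b h\<^sub>0 = scale_vec z' h\<^sub>0"
      by blast
    then have "a \<oplus>\<^bsub>A\<^esub> b \<in> carrier A" "(a \<oplus>\<^bsub>A\<^esub> b) \<odot>\<^bsub>V\<^esub> v = hecke_const q (z + z') \<odot>\<^bsub>V\<^esub> v"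
      using v by (simp_all add: V.smult_l_distr V_const_add)
    moreover have "hecke_act (a \<oplus>\<^bsub>hecke q\<^esub> b) h\<^sub>0 = scale_vec (z + z') h\<^sub>0"
      using z A_sub by (subst hecke_act_plus) auto
    ultimately show ?case unfolding A_simps by blast
  next
    case (eng_mult a b)
    then obtain z z' where z: "a \<in> carrier A" "a \<odot>\<^bsub>V\<^esub> v = hecke_const q z \<odot>\<^bsub>V\<^esub> v" "hecke_act a h\<^sub>0 = scale_vec z h\<^sub>0"
      "b \<in> carrier A" "b \<odot>\<^bsub>V\<^esub> v = hecke_const q z' \<odot>\<^bsub>V\<^esub> v" "hecke_act b h\<^sub>0 = scale_vec z' h\<^sub>0"
      by blast
    have aR: "a \<in> carrier (hecke q)" and bR: "b \<in> carrier (hecke q)" using z A_sub by auto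
    have "a \<otimes>\<^bsub>A\<^esub> hecke_const q z' = hecke_const q z' \<otimes>\<^bsub>A\<^esub> a"
      using aR by (simp add: A_simps hecke_const_central)
    then have "a \<odot>\<^bsub>V\<^esub> (hecke_const q z' \<odot>\<^bsub>V\<^esub> v) = hecke_const q z' \<odot>\<^bsub>V\<^esub> (a \<odot>\<^bsub>V\<^esub> v)"
      using z v A_generators by (metis V.smult_assoc)
    then have "a \<otimes>\<^bsub>A\<^esub> b \<in> carrier A" "(a \<otimes>\<^bsub>A\<^esub> b) \<odot>\<^bsub>V\<^esub> v = hecke_const q (z' * z) \<odot>\<^bsub>V\<^esub> v"
      using z v by (simp_all add: V.smult_assoc V_const_const)
    moreover have "hecke_act (a \<otimes>\<^bsub>hecke q\<^esub> b) h\<^sub>0 = scale_vec (z' * z) h\<^sub>0"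
      using z aR bR by (simp only: hecke_act_mult hecke_act_scale scale_vec.scale_scale)
    ultimately show ?case unfolding A_simps by blast
  qed
  then show ?thesis using that by blast
qed

text \<open>The homomorphism to the model that sends \<open>1 \<otimes> v\<close> to \<open>h\<^sub>0\<close>, by the universal property.\<close>

lemma coordinate_map:
  obtains \<theta> :: "(hecke_elt \<times> 'v \<Rightarrow>\<^sub>0 int) set \<Rightarrow> vec"
  where "\<And>x y. x \<in> carrier M \<Longrightarrow> y \<in> carrier M \<Longrightarrow> \<theta> (x \<oplus>\<^bsub>M\<^esub> y) = \<theta> x + \<theta> y"
    and "\<And>a x. a \<in> carrier (hecke q) \<Longrightarrow> x \<in> carrier M \<Longrightarrow> \<theta> (a \<odot>\<^bsub>M\<^esub> x) = hecke_act a (\<theta> x)"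
    and "\<theta> (pure \<one>\<^bsub>hecke q\<^esub> v) = h\<^sub>0"
proof -
  let ?\<beta> = "\<lambda>h w. hecke_act h (scale_vec (coeff w) h\<^sub>0)"
  have bal: "?\<beta> (h \<otimes>\<^bsub>hecke q\<^esub> a) w = ?\<beta> h (a \<odot>\<^bsub>V\<^esub> w)"
    if h: "h \<in> carrier (hecke q)" and a: "a \<in> carrier A" and w: "w \<in> carrier V" for h a w
  proof -
    obtain z where z: "a \<odot>\<^bsub>V\<^esub> v = hecke_const q z \<odot>\<^bsub>V\<^esub> v" "hecke_act a h\<^sub>0 = scale_vec z h\<^sub>0"
      using parabolic_scalar[OF a] by blast
    have aR: "a \<in> carrier (hecke q)" using a A_sub by auto
    have "a \<otimes>\<^bsub>A\<^esub> hecke_const q (coeff w) = hecke_const q (coeff w) \<otimes>\<^bsub>A\<^esub> a"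
      using aR by (simp add: A_simps hecke_const_central)
    then have "a \<odot>\<^bsub>V\<^esub> (hecke_const q (coeff w) \<odot>\<^bsub>V\<^esub> v) = hecke_const q (coeff w) \<odot>\<^bsub>V\<^esub> (a \<odot>\<^bsub>V\<^esub> v)"
      using a v A_generators by (metis V.smult_assoc)
    then have "a \<odot>\<^bsub>V\<^esub> w = hecke_const q (coeff w * z) \<odot>\<^bsub>V\<^esub> v"
      using w v by (simp add: coeff z V_const_const)
    then have "coeff (a \<odot>\<^bsub>V\<^esub> w) = coeff w * z" by (simp only: coeff_const)
    then show ?thesis
      using h aR z by (simp only: hecke_act_mult hecke_act_scale scale_vec.scale_scale)
  qed
  obtain \<theta> where \<theta>: "\<And>x y. x \<in> carrier M \<Longrightarrow> y \<in> carrier M \<Longrightarrow> \<theta> (x \<oplus>\<^bsub>M\<^esub> y) = \<theta> x + \<theta> y"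
      "\<And>h w. h \<in> carrier (hecke q) \<Longrightarrow> w \<in> carrier V \<Longrightarrow> \<theta> (pure h w) = ?\<beta> h w"
  proof (rule induced_universal[of ?\<beta>])
    show "?\<beta> (g \<oplus>\<^bsub>hecke q\<^esub> h) w = ?\<beta> g w + ?\<beta> h w"
      if "g \<in> carrier (hecke q)" "h \<in> carrier (hecke q)" for g h w
      using that by (rule hecke_act_plus)
    show "?\<beta> h (w \<oplus>\<^bsub>V\<^esub> w') = ?\<beta> h w + ?\<beta> h w'" if "w \<in> carrier V" "w' \<in> carrier V" for h w w'
      using that by (simp only: coeff_add scale_vec.scale_left_distrib hecke_act_add)
  qed (rule bal, assumption+, rule that)
  show thesis
  proof (rule that)
    fix a x assume a: "a \<in> carrier (hecke q)" and x: "x \<in> carrier M"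
    have neg: "\<theta> (\<ominus>\<^bsub>M\<^esub> y) = - \<theta> y" if "y \<in> carrier M" for y
      using \<theta>(1)[of y "\<ominus>\<^bsub>M\<^esub> y"] \<theta>(1)[of "\<zero>\<^bsub>M\<^esub>" "\<zero>\<^bsub>M\<^esub>"] that
      by (simp add: I.M.r_neg add_eq_0_iff)
    have act_neg: "hecke_act a (- y) = - hecke_act a y" for y
      using hecke_act_add[of a y "- y"] hecke_act_add[of a 0 0] by (simp add: add_eq_0_iff)
    from x show "\<theta> (a \<odot>\<^bsub>M\<^esub> x) = hecke_act a (\<theta> x)"
    proof (induction rule: induced_induct)
      case (pure h w)
      then show ?case using a by (simp add: smult_pure \<theta>(2) hecke_act_mult)
    next
      case (add x y)
      then show ?case using a by (simp add: I.smult_r_distr \<theta>(1) I.smult_closed hecke_act_add)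
    next
      case (minus x)
      then show ?case using a by (simp add: I.smult_minus neg I.smult_closed act_neg)
    qed
  qed (use \<theta> v coeff_const[of 1] in \<open>simp_all add: V_const_one hecke_act_one\<close>)
qed


abbreviation "node i \<equiv> if even (i::nat) then N1 else N2"

text \<open>The vectors \<open>T\<^sub>w \<otimes> v\<close>, where \<open>w\<close> runs through the six minimal representatives \<open>1, s\<^sub>1, s\<^sub>2s\<^sub>1, \<dots>\<close> of the left
cosets of \<open>\<langle>s\<^sub>2\<rangle>\<close> in the Weyl group, continued indefinitely to keep the recursion simple.\<close>

primrec basis :: "nat \<Rightarrow> (hecke_elt \<times> 'v \<Rightarrow>\<^sub>0 int) set" where
  "basis 0 = pure \<one>\<^bsub>hecke q\<^esub> v"
| "basis (Suc i) = hecke_T q (node i) \<odot>\<^bsub>M\<^esub> basis i"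

abbreviation "S \<equiv> M.const_span basis 6"

lemma basis_closed: "basis i \<in> carrier M"
  by (induction i) (simp_all add: pure_closed v I.smult_closed)

lemmas S_closed = M.const_span_add[OF basis_closed] M.const_span_const[OF basis_closed]
  M.const_span_base[OF basis_closed]

lemma pure_one_const: "hecke_const q c \<odot>\<^bsub>M\<^esub> pure \<one>\<^bsub>hecke q\<^esub> w = pure \<one>\<^bsub>hecke q\<^esub> (hecke_const q c \<odot>\<^bsub>V\<^esub> w)"
  if "w \<in> carrier V"
  using that pure_balanced[of "\<one>\<^bsub>hecke q\<^esub>" "hecke_const q c" w]
  by (simp add: smult_pure A_generators)

lemma T2_basis_0: "hecke_T q N2 \<odot>\<^bsub>M\<^esub> basis 0 = hecke_const q q \<odot>\<^bsub>M\<^esub> basis 0"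
  unfolding basis.simps pure_one_const[OF v(1)]
  using v pure_balanced[of "\<one>\<^bsub>hecke q\<^esub>" "hecke_T q N2" v] by (simp add: smult_pure A_generators T_v)

lemma X_basis_0: "hecke_X q l \<odot>\<^bsub>M\<^esub> basis 0 = hecke_const q (weight_at (inverse \<rho>) (-1) l) \<odot>\<^bsub>M\<^esub> basis 0"
  unfolding basis.simps pure_one_const[OF v(1)]
  using v pure_balanced[of "\<one>\<^bsub>hecke q\<^esub>" "hecke_X q l" v] by (simp add: smult_pure A_generators X_v)

lemma T_basis: "hecke_T q (node i) \<odot>\<^bsub>M\<^esub> basis (Suc i) = hecke_const q (q - inverse q) \<odot>\<^bsub>M\<^esub> basis (Suc i) \<oplus>\<^bsub>M\<^esub> basis i"
  unfolding basis.simps by (rule M.T_square[OF basis_closed])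

lemma basis_5: "basis 5 = hecke_T q N1 \<odot>\<^bsub>M\<^esub> (hecke_T q N2 \<odot>\<^bsub>M\<^esub> (hecke_T q N1 \<odot>\<^bsub>M\<^esub>
    (hecke_T q N2 \<odot>\<^bsub>M\<^esub> (hecke_T q N1 \<odot>\<^bsub>M\<^esub> basis 0))))"
proof -
  have five: "(5::nat) = Suc (Suc (Suc (Suc (Suc 0))))" by simp
  show ?thesis unfolding five basis.simps by simp
qed

text \<open>The braid relation moves \<open>T\<^sub>2\<close> to the right end of the word, where it meets \<open>v\<close>.\<close>

lemma T2_basis_5: "hecke_T q N2 \<odot>\<^bsub>M\<^esub> basis 5 = hecke_const q q \<odot>\<^bsub>M\<^esub> basis 5"
proof -
  have "hecke_T q N2 \<odot>\<^bsub>M\<^esub> basis 5 = hecke_T q N1 \<odot>\<^bsub>M\<^esub> (hecke_T q N2 \<odot>\<^bsub>M\<^esub> (hecke_T q N1 \<odot>\<^bsub>M\<^esub> (hecke_T q N2 \<odot>\<^bsub>M\<^esub>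
      (hecke_T q N1 \<odot>\<^bsub>M\<^esub> (hecke_T q N2 \<odot>\<^bsub>M\<^esub> basis 0)))))"
    unfolding basis_5 by (rule M.braid[OF basis_closed, symmetric])
  also have "\<dots> = hecke_const q q \<odot>\<^bsub>M\<^esub> basis 5"
    using basis_closed[of 0] unfolding basis_5
    by (simp add: T2_basis_0 M.const_commute I.smult_closed del: basis.simps)
  finally show ?thesis .
qed

lemma T_S:
  assumes x: "x \<in> S"
  shows "hecke_T q j \<odot>\<^bsub>M\<^esub> x \<in> S"
proof (rule M.const_span_smult[OF basis_closed _ _ x])
  fix i :: nat assume i: "i < 6"
  show "hecke_T q j \<odot>\<^bsub>M\<^esub> basis i \<in> S"
  proof (cases "j = node i")
    case True
    show ?thesis
    proof (cases "i = 5")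
      case True
      have "hecke_const q q \<odot>\<^bsub>M\<^esub> basis 5 \<in> S" by (intro S_closed) simp
      then show ?thesis using True \<open>j = node i\<close> T2_basis_5 by simp
    next
      case False
      then have "basis (Suc i) \<in> S" using i by (intro S_closed) simp
      then show ?thesis using True by simp
    qed
  next
    case False
    show ?thesis
    proof (cases i)
      case 0
      then have "j = N2" using False by (cases j) auto
      moreover have "hecke_const q q \<odot>\<^bsub>M\<^esub> basis 0 \<in> S" by (intro S_closed) simp
      ultimately show ?thesis using 0 T2_basis_0 by simp
    next
      case (Suc k)
      then have "j = node k" using False by (cases j) (auto split: if_splits)
      moreover have "hecke_const q (q - inverse q) \<odot>\<^bsub>M\<^esub> basis (Suc k) \<oplus>\<^bsub>M\<^esub> basis k \<in> S"
        using i Suc by (intro S_closed) simp_all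
      ultimately show ?thesis using Suc T_basis[of k] by simp
    qed
  qed
qed simp

lemma X_S:
  assumes x: "x \<in> S"
  shows "hecke_X q l \<odot>\<^bsub>M\<^esub> x \<in> S"
proof (rule M.const_span_smult[OF basis_closed _ _ x])
  fix i :: nat assume "i < 6"
  then show "hecke_X q l \<odot>\<^bsub>M\<^esub> basis i \<in> S"
  proof (induction i arbitrary: l)
    case 0
    show ?case unfolding X_basis_0 by (intro S_closed) simp
  next
    case (Suc i)
    show ?case unfolding basis.simps
      by (rule M.const_span_X[OF basis_closed T_S]) (use Suc in \<open>auto intro: S_closed\<close>)
  qed
qed simp

lemma S_carrier: "carrier M = S"
proof
  show "S \<subseteq> carrier M" by (rule M.const_span_sub[OF basis_closed])
  show "carrier M \<subseteq> S"
  proof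
    fix x assume "x \<in> carrier M"
    then show "x \<in> S"
    proof (induction rule: induced_induct)
      case (pure h w)
      have w: "hecke_const q (coeff w) \<odot>\<^bsub>M\<^esub> basis 0 = pure \<one>\<^bsub>hecke q\<^esub> w"
        unfolding basis.simps pure_one_const[OF v(1)] coeff[OF pure(2)] ..
      have eq: "pure h w = h \<odot>\<^bsub>M\<^esub> (hecke_const q (coeff w) \<odot>\<^bsub>M\<^esub> basis 0)"
        unfolding w using pure by (simp add: smult_pure)
      have "hecke_const q (coeff w) \<odot>\<^bsub>M\<^esub> basis 0 \<in> S" by (intro S_closed) simp
      with pure(1) show ?case unfolding eq
        by (rule hecke_stable_subset[OF induced_is_left_module \<open>S \<subseteq> carrier M\<close>, rotated 4])
          (intro S_closed T_S X_S; assumption)+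
    next
      case (add x y)
      then show ?case by (intro S_closed)
    next
      case (minus x)
      have "hecke_const q (-1) \<odot>\<^bsub>M\<^esub> x \<in> S" by (intro S_closed minus)
      then show ?case using minus by (simp add: M.const_minus_one)
    qed
  qed
qed

primrec model_basis :: "nat \<Rightarrow> vec" where
  "model_basis 0 = h\<^sub>0"
| "model_basis (Suc i) = scale_vec q (Uop \<rho> (node i) (model_basis i))"

lemma model_basis_values:
  "model_basis 1 = scale_vec q (2 * \<rho>, 0, 1, 0, 0, 0)"
  "model_basis 2 = scale_vec (-1) (2 * \<rho>, 0, 1, 1, 0, 0)"
  "model_basis 3 = scale_vec (-q) (7 - 12 * \<rho>, 3, -2, 2 - 2 * \<rho>, 0, 0)"
  "model_basis 4 = (4 - 12 * \<rho>, 3, -2, -2 * \<rho>, 3, 0)"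
  "model_basis 5 = scale_vec q (-2, 0, 0, -1, 4 - 2 * \<rho>, 3)"
proof -
  note [simp] = U_scale q_mult \<rho>_normal_form
  show 1: "model_basis 1 = scale_vec q (2 * \<rho>, 0, 1, 0, 0, 0)"
    by (simp add: One_nat_def del: scale_vec.simps)
  have "model_basis 2 = scale_vec q (Uop \<rho> N2 (model_basis 1))" by (simp add: numeral_2_eq_2)
  then show 2: "model_basis 2 = scale_vec (-1) (2 * \<rho>, 0, 1, 1, 0, 0)"
    unfolding 1 U_scale scale_vec.scale_scale q_mult by simp
  have "model_basis 3 = scale_vec q (Uop \<rho> N1 (model_basis 2))" by (simp add: numeral_3_eq_3 numeral_2_eq_2)
  then show 3: "model_basis 3 = scale_vec (-q) (7 - 12 * \<rho>, 3, -2, 2 - 2 * \<rho>, 0, 0)"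
    unfolding 2 U_scale scale_vec.scale_scale by simp
  have "model_basis 4 = scale_vec q (Uop \<rho> N2 (model_basis 3))"
    using model_basis.simps(2)[of 3] by simp
  then show 4: "model_basis 4 = (4 - 12 * \<rho>, 3, -2, -2 * \<rho>, 3, 0)"
    unfolding 3 U_scale scale_vec.scale_scale by simp
  have "model_basis 5 = scale_vec q (Uop \<rho> N1 (model_basis 4))"
    using model_basis.simps(2)[of 4] by simp
  then show "model_basis 5 = scale_vec q (-2, 0, 0, -1, 4 - 2 * \<rho>, 3)"
    unfolding 4 by simp
qed

text \<open>In the order \<open>f\<^sub>2, f\<^sub>1, h\<^sub>1, g\<^sub>1, g\<^sub>0, h\<^sub>0\<close> of the coordinates the six vectors are triangular.\<close>

lemma model_basis_independent:
  assumes "(\<Sum>i<6. scale_vec (c i) (model_basis i)) = 0" and "i < 6"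
  shows "c i = 0"
proof -
  have "(\<Sum>i<6. scale_vec (c i) (model_basis i)) = scale_vec (c 0) (model_basis 0) + scale_vec (c 1) (model_basis 1) +
      scale_vec (c 2) (model_basis 2) + scale_vec (c 3) (model_basis 3) + scale_vec (c 4) (model_basis 4) +
      scale_vec (c 5) (model_basis 5)"
    by (simp add: eval_nat_numeral lessThan_Suc add_ac del: model_basis.simps)
  then have eq: "\<dots> = (0, 0, 0, 0, 0, 0)" using assms(1) by (simp add: zero_prod_def)
  have "c 5 = 0" using eq q_nz unfolding model_basis_values by auto
  moreover from this have "c 4 = 0" using eq unfolding model_basis_values by auto
  moreover from calculation have "c 3 = 0" using eq q_nz unfolding model_basis_values by auto
  moreover from calculation have "c 2 = 0" using eq unfolding model_basis_values by auto
  moreover from calculation have "c 1 = 0" using eq q_nz unfolding model_basis_values by auto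
  moreover from calculation have "c 0 = 0" using eq unfolding model_basis_values by auto
  moreover have "i = 0 \<or> i = 1 \<or> i = 2 \<or> i = 3 \<or> i = 4 \<or> i = 5" using assms(2) by linarith
  ultimately show ?thesis by metis
qed

text \<open>The map to the model is injective because the six vectors that span the induced module have
independent images, and surjective because \<open>h\<^sub>0\<close> generates the model.\<close>

theorem exists_model: "\<exists>\<theta>. hecke_model q \<rho> M \<theta>"
proof -
  obtain \<theta> where \<theta>: "\<And>x y. x \<in> carrier M \<Longrightarrow> y \<in> carrier M \<Longrightarrow> \<theta> (x \<oplus>\<^bsub>M\<^esub> y) = \<theta> x + \<theta> y"
    "\<And>a x. a \<in> carrier (hecke q) \<Longrightarrow> x \<in> carrier M \<Longrightarrow> \<theta> (a \<odot>\<^bsub>M\<^esub> x) = hecke_act a (\<theta> x)"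
    "\<theta> (pure \<one>\<^bsub>hecke q\<^esub> v) = h\<^sub>0"
    using coordinate_map by metis
  have \<theta>0: "\<theta> \<zero>\<^bsub>M\<^esub> = 0" using \<theta>(1)[of "\<zero>\<^bsub>M\<^esub>" "\<zero>\<^bsub>M\<^esub>"] by simp
  have basis: "\<theta> (basis i) = model_basis i" for i
    by (induction i) (simp_all add: \<theta> basis_closed hecke_act_T)
  have sum: "\<theta> (\<Oplus>\<^bsub>M\<^esub>i\<in>A. hecke_const q (c i) \<odot>\<^bsub>M\<^esub> basis i) = (\<Sum>i\<in>A. scale_vec (c i) (model_basis i))"
    if "finite A" for A c
    using that
  proof (induction A rule: finite_induct)
    case (insert i A)
    have "(\<Oplus>\<^bsub>M\<^esub>i\<in>insert i A. hecke_const q (c i) \<odot>\<^bsub>M\<^esub> basis i)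
      = hecke_const q (c i) \<odot>\<^bsub>M\<^esub> basis i \<oplus>\<^bsub>M\<^esub> (\<Oplus>\<^bsub>M\<^esub>i\<in>A. hecke_const q (c i) \<odot>\<^bsub>M\<^esub> basis i)"
      using insert by (intro I.M.finsum_insert) (auto simp: basis_closed I.smult_closed)
    moreover have "(\<Oplus>\<^bsub>M\<^esub>i\<in>A. hecke_const q (c i) \<odot>\<^bsub>M\<^esub> basis i) \<in> carrier M"
      by (intro I.M.finsum_closed) (auto simp: basis_closed I.smult_closed)
    ultimately show ?case
      using insert by (simp add: \<theta> basis_closed I.smult_closed basis hecke_act_const)
  qed (simp add: \<theta>0)
  have ker: "x = \<zero>\<^bsub>M\<^esub>" if x: "x \<in> carrier M" "\<theta> x = 0" for x
  proof -
    obtain c where c: "x = (\<Oplus>\<^bsub>M\<^esub>i\<in>{..<6}. hecke_const q (c i) \<odot>\<^bsub>M\<^esub> basis i)"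
      using x(1) unfolding S_carrier M.const_span_def by auto
    have "c i = 0" if "i < 6" for i
      using model_basis_independent[OF _ that, of c] x(2) unfolding c sum[OF finite_lessThan] by simp
    then have "x = (\<Oplus>\<^bsub>M\<^esub>i\<in>{..<6::nat}. \<zero>\<^bsub>M\<^esub>)"
      unfolding c by (intro I.M.finsum_cong') (auto simp: M.const_zero basis_closed)
    then show ?thesis by simp
  qed
  have inj: "inj_on \<theta> (carrier M)"
  proof (rule inj_onI)
    fix x y assume xy: "x \<in> carrier M" "y \<in> carrier M" "\<theta> x = \<theta> y"
    have "\<theta> (x \<oplus>\<^bsub>M\<^esub> \<ominus>\<^bsub>M\<^esub> y) = \<theta> (y \<oplus>\<^bsub>M\<^esub> \<ominus>\<^bsub>M\<^esub> y)" using xy by (simp add: \<theta>(1) del: I.M.r_neg)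
    then have "\<theta> (x \<oplus>\<^bsub>M\<^esub> \<ominus>\<^bsub>M\<^esub> y) = 0" using xy by (simp add: I.M.r_neg \<theta>0)
    then have "x \<oplus>\<^bsub>M\<^esub> \<ominus>\<^bsub>M\<^esub> y = \<zero>\<^bsub>M\<^esub>" using xy by (intro ker) simp_all
    then show "x = y" using xy I.M.minus_equality[of x "\<ominus>\<^bsub>M\<^esub> y"] by simp
  qed
  have "stable (\<theta> ` carrier M)"
  proof -
    have image: "hecke_act a (\<theta> x) \<in> \<theta> ` carrier M" if "a \<in> carrier (hecke q)" "x \<in> carrier M" for a x
      using that by (intro image_eqI[of _ _ "a \<odot>\<^bsub>M\<^esub> x"]) (simp_all add: \<theta> I.smult_closed)
    have const: "scale_vec c (\<theta> x) \<in> \<theta> ` carrier M" if "x \<in> carrier M" for c x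
      using image[of "hecke_const q c" x] that by (simp add: hecke_act_const)
    have "Xop \<rho> l (\<theta> x) \<in> \<theta> ` carrier M" if "x \<in> carrier M" for l x
      using image[of "hecke_X q l" x] that by (simp add: hecke_act_X)
    moreover have "Uop \<rho> i (\<theta> x) \<in> \<theta> ` carrier M" if x: "x \<in> carrier M" for i x
    proof -
      have "Uop \<rho> i (\<theta> x) = scale_vec (- q) (\<theta> (hecke_T q i \<odot>\<^bsub>M\<^esub> x))"
        using x by (simp only: \<theta>(2) hecke_T_closed hecke_act_T vec_op.simps scale_vec.scale_scale) (simp add: q_mult)
      then show ?thesis using const[of "hecke_T q i \<odot>\<^bsub>M\<^esub> x" "-q"] x by (simp only: I.smult_closed hecke_T_closed)
    qed
    moreover have "\<theta> x + \<theta> y \<in> \<theta> ` carrier M" if "x \<in> carrier M" "y \<in> carrier M" for x y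
      using that by (intro image_eqI[of _ _ "x \<oplus>\<^bsub>M\<^esub> y"]) (simp_all add: \<theta>)
    ultimately show ?thesis unfolding stable_def using const by auto
  qed
  moreover have "h\<^sub>0 \<in> \<theta> ` carrier M"
    using \<theta>(3) v by (intro image_eqI[of _ _ "pure \<one>\<^bsub>hecke q\<^esub> v"]) (simp_all add: pure_closed)
  ultimately have "\<theta> ` carrier M = UNIV" using stable_generated_by_h0 by blast
  then have "hecke_model q \<rho> M \<theta>"
    using inj \<theta> by (intro hecke_model.intro sixth_root_axioms M.hecke_module_axioms hecke_model_axioms.intro)
      (auto simp: bij_betw_def)
  then show ?thesis by (rule exI[of _ \<theta>])
qed

end

section \<open>The two modules\<close>

text \<open>For the second module \<open>\<rho>\<close> is inverted, which exchanges the two weights; hence the second claim.\<close>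

lemma (in line_induction) weight_space_submodule:
  fixes u1 u2
  defines "u1 \<equiv> weight_at (- inverse \<rho>) (-1)" and "u2 \<equiv> weight_at (- \<rho>) (-1)"
  defines "SM \<equiv> weight_space q M u1 <+>\<^bsub>M\<^esub> weight_space q M u2"
  shows "left_module (hecke q) M \<and> submodule SM (hecke q) M \<and>
         irreducible_module (hecke q) (M\<lparr>carrier := SM\<rparr>) \<and>
         has_complex_dim q (M\<lparr>carrier := SM\<rparr>) 2 \<and>
         irreducible_module (hecke q) (quotient_module M SM)"
    and "SM = weight_space q M u2 <+>\<^bsub>M\<^esub> weight_space q M u1"
proof -
  obtain \<theta> where "hecke_model q \<rho> M \<theta>" using exists_model by blast
  then interpret model: hecke_model q \<rho> M \<theta> .
  have SM: "SM = model.weight_plane"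
    unfolding SM_def u1_def u2_def by (rule model.weight_spaces_sum)
  show "left_module (hecke q) M \<and> submodule SM (hecke q) M \<and>
         irreducible_module (hecke q) (M\<lparr>carrier := SM\<rparr>) \<and>
         has_complex_dim q (M\<lparr>carrier := SM\<rparr>) 2 \<and>
         irreducible_module (hecke q) (quotient_module M SM)"
    unfolding SM
    by (intro conjI induced_is_left_module model.submodule_weight_plane model.irreducible_weight_plane model.dim_weight_plane
        model.irreducible_quotient)
  have "weight_space q M u <+>\<^bsub>M\<^esub> weight_space q M u' \<subseteq> weight_space q M u' <+>\<^bsub>M\<^esub> weight_space q M u" for u u'
  proof
    fix x assume "x \<in> weight_space q M u <+>\<^bsub>M\<^esub> weight_space q M u'"
    then obtain y z where yz: "x = y \<oplus>\<^bsub>M\<^esub> z" "y \<in> weight_space q M u" "z \<in> weight_space q M u'"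
      unfolding set_add_def' by blast
    then have "x = z \<oplus>\<^bsub>M\<^esub> y" unfolding weight_space_def using I.M.a_comm by blast
    then show "x \<in> weight_space q M u' <+>\<^bsub>M\<^esub> weight_space q M u" unfolding set_add_def' using yz by blast
  qed
  then show "SM = weight_space q M u2 <+>\<^bsub>M\<^esub> weight_space q M u1"
    unfolding SM_def by (intro equalityI)
qed

lemma weyl_act_comp:
  "bij f \<Longrightarrow> bij g \<Longrightarrow> weyl_act (f \<circ> g) t = weyl_act f (weyl_act g t)"
  by (auto simp: weyl_act_def o_inv_distrib fun_eq_iff)

lemma bij_simple_refl: "bij (simple_refl i)"
  by (rule involuntory_imp_bij) (rule simple_refl_refl)

lemma weyl_act_simple_refl_weight_at:
  assumes "z \<noteq> 0" "w \<noteq> 0"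
  shows "weyl_act (simple_refl N1) (weight_at z w) = weight_at (inverse z) (z ^ 3 * w)"
    and "weyl_act (simple_refl N2) (weight_at z w) = weight_at (z * w) (inverse w)"
proof -
  have "z powi (b * 3 - a) * w powi b = inverse z powi a * (z ^ 3 * w) powi b" for a b
  proof -
    have "z powi (b * 3 - a) = z powi (3 * b) / z powi a"
      using assms by (simp add: power_int_diff mult.commute)
    also have "z powi (3 * b) = (z ^ 3) powi b" by (simp add: power_int_mult)
    finally show ?thesis by (simp add: power_int_mult_distrib power_int_inverse field_simps)
  qed
  moreover have "z powi a * w powi (a - b) = (z * w) powi a * inverse w powi b" for a b
    using assms by (simp add: power_int_diff power_int_mult_distrib power_int_inverse field_simps)
  ultimately show "weyl_act (simple_refl N1) (weight_at z w) = weight_at (inverse z) (z ^ 3 * w)"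
    and "weyl_act (simple_refl N2) (weight_at z w) = weight_at (z * w) (inverse w)"
    by (simp_all add: weyl_act_def inv_simple_refl simple_refl_def coroot_pairing_def root_multiple_def
      weight_at_def fun_eq_iff)
qed

theorem proposition33:
  fixes q r :: complex
    and t t' u1 u2 :: weight and w0 :: "lattice \<Rightarrow> lattice"
    and V :: "(hecke_elt, 'v) module" and v :: 'v
    and V' :: "(hecke_elt, 'w) module" and v' :: 'w
  assumes "q \<noteq> 0" and "q ^ 2 = -1"
    and "r \<noteq> 0" and "r ^ 3 = q ^ 2"
    and "r \<notin> {q ^ 2, inverse (q ^ 2), q, - q, inverse q, - inverse q}"
    and "t = weight_at r 1"
    and "t' = weyl_act (simple_refl N1) t"
    and "w0 = simple_refl N1 \<circ> simple_refl N2 \<circ> simple_refl N1 \<circ> simple_refl N2 \<circ> simple_refl N1 \<circ> simple_refl N2"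
    and "parabolic_line q N2 q t' V v"
    and "parabolic_line q N2 (- inverse q) (weyl_act w0 t') V' v'"
    and "M = induced_module (hecke q) (hecke_parabolic q N2) V"
    and "N = induced_module (hecke q) (hecke_parabolic q N2) V'"
    and "u1 = weyl_act (simple_refl N2 \<circ> simple_refl N1) t"
    and "u2 = weyl_act (simple_refl N1 \<circ> simple_refl N2 \<circ> simple_refl N1) t"
    and "SM = weight_space q M u1 <+>\<^bsub>M\<^esub> weight_space q M u2"
    and "SN = weight_space q N u1 <+>\<^bsub>N\<^esub> weight_space q N u2"
  shows "left_module (hecke q) M \<and> submodule SM (hecke q) M \<and>
         irreducible_module (hecke q) (M\<lparr>carrier := SM\<rparr>) \<and>
         has_complex_dim q (M\<lparr>carrier := SM\<rparr>) 2 \<and>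
         irreducible_module (hecke q) (quotient_module M SM) \<and>
         left_module (hecke q) N \<and> submodule SN (hecke q) N \<and>
         irreducible_module (hecke q) (N\<lparr>carrier := SN\<rparr>) \<and>
         has_complex_dim q (N\<lparr>carrier := SN\<rparr>) 2 \<and>
         irreducible_module (hecke q) (quotient_module N SN)"
proof -
  (* r is a root of the second factor, since the first one vanishes only at -1 = q^2. *)
  have "(r + 1) * (r ^ 2 - r + 1) = r ^ 3 + 1"
    by (simp add: algebra_simps power2_eq_square power3_eq_cube)
  moreover have "r \<noteq> -1" using assms(2,5) by auto
  ultimately have "r ^ 2 - r + 1 = 0" using assms(2,4) by (simp add: add_eq_0_iff2)
  then have r2: "r ^ 2 = r - 1" by (simp add: algebra_simps)
  interpret M: sixth_root q r by unfold_locales (rule assms(2) r2)+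
  have "inverse r ^ 2 = inverse r - 1"
    using r2 by (simp add: M.inverse_\<rho> power2_eq_square algebra_simps)
  then interpret N: sixth_root q "inverse r" by unfold_locales (rule assms(2))
  have r3: "r ^ 3 = -1" using assms(2,4) by simp
  then have r3': "inverse r ^ 3 = -1" by (simp add: power_inverse)
  note weights = weyl_act_comp bij_comp bij_simple_refl weyl_act_simple_refl_weight_at assms(3)
    r3 r3'
  have t': "t' = weight_at (inverse r) (-1)" by (simp add: assms(6,7) weights)
  have u1: "u1 = weight_at (- inverse r) (-1)" by (simp add: assms(6,13) weights)
  have u2: "u2 = weight_at (- r) (-1)" by (simp add: assms(6,14) weights)
  have w0t': "weyl_act w0 t' = weight_at (inverse (inverse r)) (-1)" by (simp add: t' assms(8) weights)
  interpret M: line_induction q r V v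
    using assms(9) unfolding t' by unfold_locales
  interpret N: line_induction q "inverse r" V' v'
    using assms(10) unfolding w0t' M.inverse_q minus_minus by unfold_locales
  have "SM = weight_space q M.M (weight_at (- inverse r) (-1)) <+>\<^bsub>M.M\<^esub> weight_space q M.M (weight_at (- r) (-1))"
    by (simp only: assms(11,15) u1 u2)
  moreover have "SN = weight_space q N.M (weight_at (- inverse (inverse r)) (-1)) <+>\<^bsub>N.M\<^esub> weight_space q N.M (weight_at (- inverse r) (-1))"
    unfolding N.weight_space_submodule(2) by (simp only: assms(12,16) u1 u2 inverse_inverse_eq)
  ultimately show ?thesis
    using M.weight_space_submodule(1) N.weight_space_submodule(1) by (simp only: assms(11,12))
qed

end
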